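(* Let $\alpha,\beta\in(0,1)$, $\lambda_1,\lambda_2>0$, and let $\{S^{\alpha,\beta}(s,t),\ (s,t)\in\mathbb{R}^2_+\}$ be the fractional Skellam random field of type one. Its distribution $p^{\alpha,\beta}(n,s,t)=\mathrm{Pr}\{S^{\alpha,\beta}(s,t)=n\}$, $n\in\mathbb{Z}$, is given by $$p^{\alpha,\beta}(n,s,t)=\bigg(\frac{\lambda_1}{\lambda_2}\bigg)^{n/2}\sum_{k=0}^{\infty}\frac{(\sqrt{\lambda_1\lambda_2}\,s^\alpha t^\beta)^{|n|+2k}}{(|n|+k)!\,k!}\;{}_2\Psi_2\left[\begin{matrix}(|n|+2k+1,1),\ (|n|+2k+1,1)\\ ((|n|+2k)\alpha+1,\alpha),\ ((|n|+2k)\beta+1,\beta)\end{matrix}\,\Bigg|\,-(\lambda_1+\lambda_2)s^{\alpha}t^{\beta}\right],$$ where ${}_2\Psi_2$ is the generalized Wright function.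
   Context: A Poisson random field on $\mathbb{R}^2_+$ with parameter $\lambda>0$ is a non-negative integer-valued random measure $\{N(B)\}$ indexed by Borel sets $B\subseteq\mathbb{R}^2_+$ such that $N(B)$ is Poisson with mean $\lambda|B|$ whenever the Lebesgue measure $|B|$ is finite, and $N(B_1),\dots,N(B_n)$ are independent for disjoint $B_1,\dots,B_n$. One writes $N(s,t)=N([0,s]\times[0,t])$. The Skellam random field is $S(s,t)=N_1(s,t)-N_2(s,t)$, where $N_1,N_2$ are independent Poisson random fields on $\mathbb{R}^2_+$ with parameters $\lambda_1,\lambda_2$. For $0<\alpha<1$, an $\alpha$-stable subordinator $\{H^\alpha(t),\ t\ge0\}$ is the non-decreasing Lévy process with $\mathbb{E}e^{-wH^\alpha(t)}=e^{-tw^\alpha}$, $w>0$; the inverse $\alpha$-stable subordinator is $E^\alpha(t)=\inf\{\tau>0:H^\alpha(\tau)>t\}$, $t\ge0$. The fractional Skellam random field of type one is $S^{\alpha,\beta}(s,t)=S(E_1^{\alpha}(s),E_2^{\beta}(t))$, where $E_1^\alpha$ and $E_2^\beta$ are inverse stable subordinators of indices $\alpha,\beta$, and $N_1,N_2,E_1^\alpha,E_2^\beta$ are mutually independent. The generalized Wright function is $${}_m\Psi_l\left[\begin{matrix}(a_1,\alpha_1),\dots,(a_m,\alpha_m)\\ (b_1,\beta_1),\dots,(b_l,\beta_l)\end{matrix}\,\Bigg|\,x\right]=\sum_{r=0}^{\infty}\frac{\prod_{i=1}^{m}\Gamma(a_i+r\alpha_i)\,x^r}{\prod_{j=1}^{l}\Gamma(b_j+r\beta_j)\,r!},\quad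 x\in\mathbb{R},$$ for $a_i,b_j\in\mathbb{R}$ and $\alpha_i,\beta_j\in\mathbb{R}\setminus\{0\}$.
   Formalization: For α+β<1 and s,t>0 the ₂Ψ₂ series diverges (terms grow like r!^(1−α−β)), as it does for α+β=1 when st is large; so the formula is proved for α+β>1, and otherwise under the hypothesis that all the ₂Ψ₂ series occurring in it converge. *)

theory Defs
  imports "HOL-Probability.Probability"
begin

section \<open>Poisson and Skellam random fields\<close>

definition quadrant :: "(real \<times> real) set" where
  "quadrant = {0..} \<times> {0..}"

text \<open>
  \<open>N w\<close> is the realisation at the outcome \<open>w\<close>: a locally finite measure on the Borel sets of
  the closed quadrant whose values are natural numbers or \<open>\<infinity>\<close>; by local finiteness only
  unbounded sets can have infinite mass. Almost sure statements about paths are replaced by sure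
  ones, as usual, so that everything is measurable without assuming that \<open>M\<close> is complete.
\<close>

definition integer_random_measure :: "'w measure \<Rightarrow> ('w \<Rightarrow> (real \<times> real) measure) \<Rightarrow> bool" where
  "integer_random_measure M N \<longleftrightarrow>
     (\<forall>w\<in>space M. sets (N w) = sets (restrict_space borel quadrant)) \<and>
     (\<forall>w\<in>space M. \<forall>B\<in>sets (restrict_space borel quadrant).
        emeasure (N w) B \<in> insert \<infinity> (range of_nat)) \<and>
     (\<forall>w\<in>space M. \<forall>B\<in>sets (restrict_space borel quadrant).
        bounded B \<longrightarrow> emeasure (N w) B < \<infinity>) \<and>
     (\<forall>B\<in>sets (restrict_space borel quadrant). (\<lambda>w. emeasure (N w) B) \<in> borel_measurable M)"

text \<open>
  The Poisson probabilities are written out, since \<open>poisson_pmf\<close> is only specified for a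
  positive rate, whereas here sets of Lebesgue measure zero (mean \<open>0\<close>) are included.
\<close>

definition poisson_random_field ::
    "'w measure \<Rightarrow> real \<Rightarrow> ('w \<Rightarrow> (real \<times> real) measure) \<Rightarrow> bool" where
  "poisson_random_field M lam N \<longleftrightarrow>
     integer_random_measure M N \<and>
     (\<forall>B\<in>sets (restrict_space borel quadrant). emeasure lborel B < \<infinity> \<longrightarrow>
        (\<forall>k::nat. measure M {w \<in> space M. emeasure (N w) B = of_nat k} =
           exp (- (lam * measure lborel B)) * (lam * measure lborel B) ^ k / fact k)) \<and>
     (\<forall>(n::nat) (B :: nat \<Rightarrow> (real \<times> real) set).
        (\<forall>i<n. B i \<in> sets (restrict_space borel quadrant)) \<longrightarrow>
        disjoint_family_on B {..<n} \<longrightarrow>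
        prob_space.indep_vars M (\<lambda>_. borel) (\<lambda>i w. emeasure (N w) (B i)) {..<n})"

definition skellam_field ::
    "('w \<Rightarrow> (real \<times> real) measure) \<Rightarrow> ('w \<Rightarrow> (real \<times> real) measure) \<Rightarrow>
     real \<Rightarrow> real \<Rightarrow> 'w \<Rightarrow> real" where
  "skellam_field N1 N2 s t w =
     measure (N1 w) ({0..s} \<times> {0..t}) - measure (N2 w) ({0..s} \<times> {0..t})"


section \<open>Stable subordinators and their inverses\<close>

text \<open>
  Processes are indexed by \<open>real\<close>; only the values at times \<open>\<ge> 0\<close> matter. Stochastic continuity
  is not listed because it follows from right-continuity and stationarity of the increments.
\<close>

definition levy_process :: "'w measure \<Rightarrow> (real \<Rightarrow> 'w \<Rightarrow> real) \<Rightarrow> bool" where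
  "levy_process M X \<longleftrightarrow>
     (\<forall>t\<ge>0. X t \<in> borel_measurable M) \<and>
     (AE w in M. X 0 w = 0) \<and>
     (\<forall>(n::nat) (t :: nat \<Rightarrow> real). 0 \<le> t 0 \<longrightarrow> mono_on {..n} t \<longrightarrow>
        prob_space.indep_vars M (\<lambda>_. borel) (\<lambda>i w. X (t (Suc i)) w - X (t i) w) {..<n}) \<and>
     (\<forall>s\<ge>0. \<forall>h\<ge>0. distr M borel (\<lambda>w. X (s + h) w - X s w) = distr M borel (X h)) \<and>
     (\<forall>w\<in>space M. \<forall>t\<ge>0. continuous (at_right t) (\<lambda>u. X u w)) \<and>
     (\<forall>w\<in>space M. \<forall>t>0. \<exists>l. ((\<lambda>u. X u w) \<longlongrightarrow> l) (at_left t))"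

definition stable_subordinator :: "'w measure \<Rightarrow> real \<Rightarrow> (real \<Rightarrow> 'w \<Rightarrow> real) \<Rightarrow> bool" where
  "stable_subordinator M \<alpha> H \<longleftrightarrow>
     levy_process M H \<and>
     (\<forall>w\<in>space M. mono_on {0..} (\<lambda>t. H t w)) \<and>
     (\<forall>t\<ge>0. \<forall>u>0. integral\<^sup>L M (\<lambda>w. exp (- u * H t w)) = exp (- t * u powr \<alpha>))"

definition inverse_process :: "(real \<Rightarrow> 'w \<Rightarrow> real) \<Rightarrow> real \<Rightarrow> 'w \<Rightarrow> real" where
  "inverse_process H t w = Inf {\<tau>. \<tau> > 0 \<and> H \<tau> w > t}"


section \<open>The fractional Skellam random field of type one\<close>

definition generated_events ::
    "'w measure \<Rightarrow> 'k set \<Rightarrow> ('k \<Rightarrow> 'w \<Rightarrow> 'b::topological_space) \<Rightarrow> 'w set set" where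
  "generated_events M K X =
     sigma_sets (space M) {X k -` A \<inter> space M | k A. k \<in> K \<and> A \<in> sets borel}"

definition field_events :: "'w measure \<Rightarrow> ('w \<Rightarrow> (real \<times> real) measure) \<Rightarrow> 'w set set" where
  "field_events M N =
     generated_events M (sets (restrict_space borel quadrant)) (\<lambda>B w. emeasure (N w) B)"

definition process_events :: "'w measure \<Rightarrow> (real \<Rightarrow> 'w \<Rightarrow> real) \<Rightarrow> 'w set set" where
  "process_events M X = generated_events M {0..} X"

definition frac_skellam_field ::
    "('w \<Rightarrow> (real \<times> real) measure) \<Rightarrow> ('w \<Rightarrow> (real \<times> real) measure) \<Rightarrow>
     (real \<Rightarrow> 'w \<Rightarrow> real) \<Rightarrow> (real \<Rightarrow> 'w \<Rightarrow> real) \<Rightarrow> real \<Rightarrow> real \<Rightarrow> 'w \<Rightarrow> real" where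
  "frac_skellam_field N1 N2 E1 E2 s t w = skellam_field N1 N2 (E1 s w) (E2 t w) w"


section \<open>The generalized Wright function\<close>

text \<open>
  The lists contain the pairs \<open>(a\<^sub>i, \<alpha>\<^sub>i)\<close> and \<open>(b\<^sub>j, \<beta>\<^sub>j)\<close>. The value \<open>wright\<close> is meaningful only
  where \<open>wright_converges\<close> holds. For \<open>x \<noteq> 0\<close> and positive parameters the series converges if
  \<open>\<Sum>\<beta>\<^sub>j - \<Sum>\<alpha>\<^sub>i > -1\<close> and diverges if \<open>\<Sum>\<beta>\<^sub>j - \<Sum>\<alpha>\<^sub>i < -1\<close>.
\<close>

definition wright_term ::
    "(real \<times> real) list \<Rightarrow> (real \<times> real) list \<Rightarrow> real \<Rightarrow> nat \<Rightarrow> real" where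
  "wright_term as bs x r =
     ((\<Prod>(a, \<alpha>)\<leftarrow>as. Gamma (a + real r * \<alpha>)) * x ^ r) /
     ((\<Prod>(b, \<beta>)\<leftarrow>bs. Gamma (b + real r * \<beta>)) * fact r)"

definition wright_converges ::
    "(real \<times> real) list \<Rightarrow> (real \<times> real) list \<Rightarrow> real \<Rightarrow> bool" where
  "wright_converges as bs x \<longleftrightarrow> summable (wright_term as bs x)"

definition wright :: "(real \<times> real) list \<Rightarrow> (real \<times> real) list \<Rightarrow> real \<Rightarrow> real" where
  "wright as bs x = (\<Sum>r. wright_term as bs x r)"

end

theory Submission
  imports Defs
begin

text \<open>
  Put \<open>X = E1 s\<close> and \<open>Y = E2 t\<close>. Given \<open>(X, Y)\<close>, the two counts on the rectangle
  \<open>[0, X] \<times> [0, Y]\<close> are independent Poisson variables with means \<open>lam1 * X * Y\<close> and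
  \<open>lam2 * X * Y\<close>. The event that their difference is \<open>n\<close> is the disjoint union over \<open>k\<close> of the
  events that the counts are \<open>n\<^sup>+ + k\<close> and \<open>n\<^sup>- + k\<close>, which have probability
  \<open>E [lam1 ^ i * lam2 ^ j / (i! * j!) * Z ^ m * exp (- (lam1 + lam2) * Z)]\<close> for \<open>Z = X * Y\<close>,
  \<open>m = i + j = \<bar>n\<bar> + 2 * k\<close>. Expanding the exponential and integrating term by term leaves the
  moments of \<open>Z\<close>, and the resulting series in \<open>r\<close> is the Wright function of the \<open>k\<close>-th summand.
  Summability over \<open>k\<close> comes for free, because the summands are, up to a common factor,
  probabilities of disjoint events.

  Three ingredients carry this argument.

  \<^item> The moments \<open>E (X ^ N) = N! / \<Gamma> (N * \<alpha> + 1) * s powr (N * \<alpha>)\<close>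
    (\<open>inverse_process_moment\<close>). Since \<open>E1 s > \<tau>\<close> essentially means \<open>H1 \<tau> \<le> s\<close>, Tonelli gives
    the Laplace transform in \<open>s\<close> of the moment from that of \<open>H1 \<tau>\<close>, and uniqueness of Laplace
    transforms (\<open>laplace_transform_unique_mono\<close>) identifies the moment. Uniqueness is derived from
    the Weierstrass approximation theorem after the substitution \<open>x = exp (- t)\<close>.

  \<^item> The conditioning on \<open>(X, Y)\<close> (\<open>prob_rect_counts_random_corner\<close>). The corner \<open>(X, Y)\<close> is
    approximated from above by dyadic points. These take countably many values, so that
    conditioning is a countable sum over products of four independent events; the counts are
    integers and continuous from above, hence eventually equal to their limit.

  \<^item> Absolute convergence of the series in \<open>r\<close> (\<open>moment_series_abs_summable\<close>), which justifies the
    termwise integration. For \<open>\<alpha> + \<beta> > 1\<close> it follows from the growth of the Gamma function.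
    Otherwise convergence for all \<open>k\<close> is given, possibly only conditional; but the moment divided
    by \<open>r!\<close> in the series for \<open>k + 1\<close> is divided by \<open>(r + 2)!\<close> in the series for \<open>k\<close>, so
    boundedness of the terms of the former forces absolute convergence of the latter.
\<close>

section \<open>Convergence of the Wright series\<close>

text \<open>
  Log-convexity of \<open>\<Gamma>\<close>, applied to \<open>y + 1\<close> as a convex combination of \<open>y + a\<close> and \<open>y + a + 1\<close>.
  It bounds the growth of \<open>\<Gamma>\<close> along steps of length \<open>a \<le> 1\<close> without Stirling's formula.
\<close>

lemma Gamma_add_lower_bound:
  fixes y a :: real
  assumes "y > 0" "0 \<le> a" "a \<le> 1"
  shows "y * Gamma y \<le> Gamma (y + a) * (y + a) powr (1 - a)"
proof (cases "a = 0")
  case True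
  then show ?thesis using assms by (simp add: mult.commute)
next
  case False
  then have a: "a > 0" using assms by simp
  have pos: "Gamma (y + a) > 0" "Gamma (y + a + 1) > 0" "Gamma (y + 1) > 0"
    using assms by (auto intro!: Gamma_real_pos)
  have G1: "Gamma (y + a + 1) = (y + a) * Gamma (y + a)"
    using assms by (intro Gamma_plus1) (auto simp: nonpos_Ints_def)
  have eq: "a * (y + a) + (1 - a) * (y + a + 1) = y + 1"
    by (simp add: algebra_simps)
  have "ln (Gamma (y + 1)) \<le> a * ln (Gamma (y + a)) + (1 - a) * ln (Gamma (y + a + 1))"
    using convex_onD[OF log_convex_Gamma_real, of "1 - a" "y + a" "y + a + 1"] assms a eq
    by simp
  also have "\<dots> = ln (Gamma (y + a)) + (1 - a) * ln (y + a)"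
  proof -
    have "ln (Gamma (y + a + 1)) = ln (y + a) + ln (Gamma (y + a))"
      using pos assms a unfolding G1 by (subst ln_mult_pos) auto
    then show ?thesis by (simp only:) (simp add: algebra_simps)
  qed
  also have "\<dots> = ln (Gamma (y + a) * (y + a) powr (1 - a))"
    using pos assms a by (subst ln_mult_pos) (auto simp: ln_powr)
  finally have "Gamma (y + 1) \<le> Gamma (y + a) * (y + a) powr (1 - a)"
    using pos assms a by (subst (asm) ln_le_cancel_iff) auto
  then show ?thesis
    using assms Gamma_plus1[of y] by (auto simp: nonpos_Ints_def)
qed

text \<open>
  The \<open>N\<close>-th moment of \<open>E1 1 * E2 1\<close> for independent inverse stable subordinators of indices
  \<open>a\<close> and \<open>b\<close>.
\<close>

definition inverse_product_moment :: "real \<Rightarrow> real \<Rightarrow> nat \<Rightarrow> real" where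
  "inverse_product_moment a b N =
     (fact N)\<^sup>2 / (Gamma (real N * a + 1) * Gamma (real N * b + 1))"

lemma inverse_product_moment_pos:
  assumes "0 < a" "0 < b"
  shows "0 < inverse_product_moment a b N"
  using assms unfolding inverse_product_moment_def
  by (intro divide_pos_pos mult_pos_pos Gamma_real_pos zero_less_power) (auto intro: add_nonneg_pos)

text \<open>
  The parameters of the Wright functions in question depend on \<open>m\<close> and the summation index \<open>r\<close>
  only through \<open>m + r\<close>, up to the factor \<open>1 / r!\<close>. This is what links different values of \<open>m\<close>.
\<close>

lemma wright_term_eq:
  "wright_term [(real (m + 1), 1), (real (m + 1), 1)]
     [(real m * a + 1, a), (real m * b + 1, b)] x r
   = inverse_product_moment a b (m + r) * x ^ r / fact r"
proof -
  have "Gamma (real (m + 1) + real r * 1) = fact (m + r)"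
    using Gamma_fact[of "m + r", where 'a = real] by (simp add: algebra_simps)
  moreover have "real m * c + 1 + real r * c = real (m + r) * c + 1" for c :: real
    by (simp only: of_nat_add) (simp add: algebra_simps)
  ultimately show ?thesis
    unfolding wright_term_def inverse_product_moment_def list.map prod_list.Nil prod_list.Cons
      prod.case mult_1_right
    by (simp only: power2_eq_square times_divide_eq_left divide_divide_eq_left mult.assoc)
qed

lemma Gamma_ratio_bound:
  fixes a :: real
  assumes "0 < a" "a \<le> 1"
  shows "Gamma (real N * a + 1) / Gamma (real (Suc N) * a + 1)
         \<le> 2 / a * (real N + 1) powr (- a)"
proof -
  define y where "y = real N * a + 1"
  have y: "y > 0" "a * (real N + 1) \<le> y" "y + a \<le> 2 * (real N + 1)"
  proof -
    show "y > 0" using assms by (auto simp: y_def intro: add_nonneg_pos)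
    have "real N * a \<le> real N" using assms by (simp add: mult_left_le)
    then show "a * (real N + 1) \<le> y" "y + a \<le> 2 * (real N + 1)"
      using assms by (auto simp: y_def algebra_simps)
  qed
  have G: "Gamma y > 0" "Gamma (y + a) > 0" using y assms by (auto intro!: Gamma_real_pos)
  have e: "real (Suc N) * a + 1 = y + a" by (simp add: y_def algebra_simps)
  have "Gamma y / Gamma (y + a) \<le> (y + a) powr (1 - a) / y"
    using Gamma_add_lower_bound[of y a] y assms G by (simp add: field_simps)
  also have "\<dots> \<le> (2 * (real N + 1)) powr (1 - a) / (a * (real N + 1))"
    using y assms by (intro frac_le powr_mono2) auto
  also have "\<dots> = 2 powr (1 - a) / a * (real N + 1) powr (- a)"
  proof -
    have "(real N + 1) powr (1 - a) = (real N + 1) * (real N + 1) powr (- a)"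
      using powr_add[of "real N + 1" 1 "- a"] by simp
    moreover have "(2 * K) powr (1 - a) / (a * K) = 2 powr (1 - a) / a * P"
      if "K > 0" "K powr (1 - a) = K * P" for K P :: real
      using that assms by (subst powr_mult) (auto simp: field_simps)
    ultimately show ?thesis by (metis of_nat_0_le_iff add_nonneg_pos zero_less_one)
  qed
  also have "\<dots> \<le> 2 / a * (real N + 1) powr (- a)"
    using assms powr_mono[of "1 - a" 1 "2::real"]
    by (intro mult_right_mono divide_right_mono) auto
  finally show ?thesis unfolding e by (simp only: y_def)
qed

lemma inverse_product_moment_Suc_le:
  assumes "0 < a" "a \<le> 1" "0 < b" "b \<le> 1"
  shows "inverse_product_moment a b (Suc N)
         \<le> 4 / (a * b) * (real N + 1) powr (2 - a - b) * inverse_product_moment a b N"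
proof -
  have G: "Gamma (real K * c + 1) > 0" if "c > 0" for K and c :: real
    using that by (auto intro!: Gamma_real_pos add_nonneg_pos)
  let ?q = "\<lambda>c. Gamma (real N * c + 1) / Gamma (real (Suc N) * c + 1)"
  have "inverse_product_moment a b (Suc N) =
          (real N + 1)\<^sup>2 * (?q a * ?q b) * inverse_product_moment a b N"
    using G[OF assms(1), of N] G[OF assms(1), of "Suc N"] G[OF assms(3), of N]
      G[OF assms(3), of "Suc N"]
    unfolding inverse_product_moment_def by (simp add: field_simps power2_eq_square)
  also have "\<dots> \<le> (real N + 1)\<^sup>2 *
      ((2 / a * (real N + 1) powr (- a)) * (2 / b * (real N + 1) powr (- b))) *
      inverse_product_moment a b N"
    using assms less_imp_le[OF inverse_product_moment_pos, of a b N]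
      less_imp_le[OF G[OF assms(3), of N]] less_imp_le[OF G[OF assms(3), of "Suc N"]]
    by (intro mult_right_mono mult_left_mono mult_mono Gamma_ratio_bound divide_nonneg_nonneg) auto
  also have "(real N + 1)\<^sup>2 * ((2 / a * (real N + 1) powr (- a)) * (2 / b * (real N + 1) powr (- b)))
      = 4 / (a * b) * ((real N + 1) powr 2 * (real N + 1) powr (- a) * (real N + 1) powr (- b))"
    using assms by (simp add: field_simps)
  also have "(real N + 1) powr 2 * (real N + 1) powr (- a) * (real N + 1) powr (- b)
      = (real N + 1) powr (2 - a - b)"
    unfolding powr_add[symmetric] by (simp add: algebra_simps)
  finally show ?thesis .
qed

text \<open>
  By the preceding bound, the ratio of consecutive terms is at most of order \<open>r powr (1 - a - b)\<close>:
  the moments contribute \<open>r powr (2 - a - b)\<close> and the factorial \<open>1 / r\<close>.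
\<close>

lemma abs_summable_of_sum_gt_1:
  assumes "0 < a" "a \<le> 1" "0 < b" "b \<le> 1" "1 < a + b"
  shows "summable (\<lambda>r. inverse_product_moment a b (m + r) * \<bar>x\<bar> ^ r / fact r)"
proof -
  \<comment> \<open>the factor \<open>m + 1\<close> absorbs \<open>(m + r + 1) / (r + 1)\<close>\<close>
  define C where "C = 4 / (a * b) * (real m + 1) * \<bar>x\<bar>"
  have lim: "(\<lambda>r. C * real (m + r + 1) powr (1 - a - b)) \<longlonglongrightarrow> C * 0"
    using assms
    by (intro tendsto_intros tendsto_neg_powr filterlim_compose[OF filterlim_real_sequentially]
        filterlim_at_top_mono[OF filterlim_ident]) auto
  then have "eventually (\<lambda>r. C * real (m + r + 1) powr (1 - a - b) < 1 / 2) sequentially"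
    by (intro order_tendstoD) auto
  then obtain R where R: "\<And>r. r \<ge> R \<Longrightarrow> C * real (m + r + 1) powr (1 - a - b) < 1 / 2"
    by (auto simp: eventually_sequentially)
  show ?thesis
  proof (rule summable_ratio_test[where c = "1 / 2" and N = R])
    fix r assume r: "R \<le> r"
    define c where "c = inverse_product_moment a b (m + r)"
    define K where "K = real (m + r) + 1"
    have c: "c > 0" unfolding c_def using assms by (intro inverse_product_moment_pos)
    have K: "K > 0" "K \<le> (real m + 1) * (real r + 1)" by (auto simp: K_def algebra_simps)
    have "inverse_product_moment a b (m + Suc r) * \<bar>x\<bar> ^ Suc r / fact (Suc r)
        \<le> (4 / (a * b) * K powr (2 - a - b) * c) * \<bar>x\<bar> ^ Suc r / fact (Suc r)"
      using inverse_product_moment_Suc_le[OF assms(1-4), of "m + r"]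
      by (intro divide_right_mono mult_right_mono) (auto simp: c_def K_def)
    also have "\<dots> = (4 / (a * b) * \<bar>x\<bar> * (K / (real r + 1)) * K powr (1 - a - b)) *
                      (c * \<bar>x\<bar> ^ r / fact r)"
    proof -
      have "K powr (2 - a - b) = K * K powr (1 - a - b)"
        using K powr_add[of K 1 "1 - a - b"] by (simp add: algebra_simps)
      then show ?thesis by (simp add: field_simps)
    qed
    also have "\<dots> \<le> (4 / (a * b) * \<bar>x\<bar> * (real m + 1) * K powr (1 - a - b)) *
                      (c * \<bar>x\<bar> ^ r / fact r)"
      using assms c K
      by (intro mult_right_mono mult_left_mono) (auto simp: field_simps)
    also have "4 / (a * b) * \<bar>x\<bar> * (real m + 1) * K powr (1 - a - b)
               = C * real (m + r + 1) powr (1 - a - b)"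
      by (simp add: C_def K_def algebra_simps)
    also have "C * real (m + r + 1) powr (1 - a - b) * (c * \<bar>x\<bar> ^ r / fact r)
               \<le> 1 / 2 * (c * \<bar>x\<bar> ^ r / fact r)"
      using R[OF r] c by (intro mult_right_mono) auto
    finally show "norm (inverse_product_moment a b (m + Suc r) * \<bar>x\<bar> ^ Suc r / fact (Suc r))
        \<le> 1 / 2 * norm (inverse_product_moment a b (m + r) * \<bar>x\<bar> ^ r / fact r)"
      using c inverse_product_moment_pos[of a b "m + Suc r"] assms by (simp add: c_def)
  qed simp
qed

text \<open>
  A convergent series has bounded terms, and term \<open>r + 2\<close> for \<open>m\<close> is term \<open>r\<close> for \<open>m + 2\<close>
  multiplied by \<open>x\<^sup>2 / ((r + 1) * (r + 2))\<close>.
\<close>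

lemma abs_summable_of_summable_shifted:
  assumes "0 < a" "0 < b"
    and "summable (\<lambda>r. inverse_product_moment a b (m + 2 + r) * x ^ r / fact r)"
  shows "summable (\<lambda>r. inverse_product_moment a b (m + r) * \<bar>x\<bar> ^ r / fact r)"
proof -
  let ?f = "\<lambda>r. inverse_product_moment a b (m + 2 + r) * x ^ r / fact r"
  have c: "inverse_product_moment a b N > 0" for N
    using assms by (intro inverse_product_moment_pos)
  have "Bseq ?f"
    using summable_LIMSEQ_zero[OF assms(3)] by (intro convergent_imp_Bseq) (auto simp: convergent_def)
  then obtain B where B: "\<And>r. norm (?f r) \<le> B" and "B > 0"
    by (auto simp: Bseq_def)
  have "summable (\<lambda>r. inverse_product_moment a b (m + (r + 2)) * \<bar>x\<bar> ^ (r + 2) / fact (r + 2))"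
  proof (rule summable_comparison_test')
    show "summable (\<lambda>r. B * x\<^sup>2 * inverse (real (Suc r) ^ 2))"
      by (intro summable_mult inverse_power_summable[where 'a = real, of 2, THEN summable_Suc_iff[THEN iffD2]]) auto
    fix r :: nat assume "0 \<le> r"
    have "norm (inverse_product_moment a b (m + (r + 2)) * \<bar>x\<bar> ^ (r + 2) / fact (r + 2))
        = norm (?f r) * x\<^sup>2 * inverse ((real r + 1) * (real r + 2))"
      using c[of "m + 2 + r"]
      by (simp add: abs_mult power_abs field_simps power2_eq_square)
    also have "\<dots> \<le> B * x\<^sup>2 * inverse (real (Suc r) ^ 2)"
      using B[of r] \<open>B > 0\<close>
      by (intro mult_mono le_imp_inverse_le)
         (auto simp: power2_eq_square algebra_simps intro!: add_pos_nonneg)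
    finally show "norm (inverse_product_moment a b (m + (r + 2)) * \<bar>x\<bar> ^ (r + 2) / fact (r + 2))
      \<le> B * x\<^sup>2 * inverse (real (Suc r) ^ 2)" .
  qed
  then show ?thesis by (subst (asm) summable_iff_shift)
qed

text \<open>
  In the second case, convergence of the series with index \<open>k + 1\<close> gives absolute convergence of
  the one with index \<open>k\<close>. This covers the boundary of the disc of convergence for \<open>\<alpha> + \<beta> = 1\<close>,
  where a single series may converge only conditionally.
\<close>

lemma moment_series_abs_summable:
  fixes x :: real and m0 :: nat
  assumes "0 < \<alpha>" "\<alpha> < 1" "0 < \<beta>" "\<beta> < 1"
    and "1 < \<alpha> + \<beta> \<or> (\<forall>k::nat. wright_converges
            [(real (m0 + 2 * k + 1), 1), (real (m0 + 2 * k + 1), 1)]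
            [(real (m0 + 2 * k) * \<alpha> + 1, \<alpha>), (real (m0 + 2 * k) * \<beta> + 1, \<beta>)] x)"
  shows "summable (\<lambda>r. inverse_product_moment \<alpha> \<beta> (m0 + 2 * k + r) * \<bar>x\<bar> ^ r / fact r)"
  using assms(5)
proof
  assume "1 < \<alpha> + \<beta>"
  then show ?thesis using assms by (intro abs_summable_of_sum_gt_1) auto
next
  assume conv: "\<forall>k::nat. wright_converges
            [(real (m0 + 2 * k + 1), 1), (real (m0 + 2 * k + 1), 1)]
            [(real (m0 + 2 * k) * \<alpha> + 1, \<alpha>), (real (m0 + 2 * k) * \<beta> + 1, \<beta>)] x"
  have e: "m0 + 2 * Suc k = m0 + 2 * k + 2" by simp
  show ?thesis
    using conv[rule_format, of "Suc k"] assms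
    unfolding wright_converges_def wright_term_eq[abs_def] e
    by (intro abs_summable_of_summable_shifted) auto
qed

section \<open>Uniqueness of Laplace transforms\<close>

text \<open>
  The integers \<open>u = j + 1\<close> suffice for the vanishing of the Laplace transform: with \<open>x = exp (- t)\<close>
  the hypothesis says that all polynomials in \<open>x\<close> integrate to zero, and polynomials are uniformly
  dense in the continuous functions on \<open>[0, 1]\<close>.
\<close>

lemma integral_continuous_comp_exp_eq_0:
  fixes h :: "real \<Rightarrow> real"
  assumes int: "set_integrable lborel {0..} (\<lambda>t. exp (- t) * h t)"
    and zero: "\<And>j::nat. (LINT t:{0..}|lborel. exp (- t) ^ j * (exp (- t) * h t)) = 0"
    and cont: "continuous_on {0..1} \<phi>"
  shows "(LINT t:{0..}|lborel. \<phi> (exp (- t)) * (exp (- t) * h t)) = 0"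
proof -
  let ?w = "\<lambda>t. indicator {0..} t * (exp (- t) * h t) :: real"
  have w: "integrable lborel ?w"
    using int by (simp add: set_integrable_def)
  have meas: "?w \<in> borel_measurable lborel" using w by (rule borel_measurable_integrable)
  have intq: "integrable lborel (\<lambda>t. q (exp (- t)) * ?w t)"
    if q: "continuous_on {0..1} q" for q :: "real \<Rightarrow> real"
  proof -
    obtain B where B: "\<And>x. x \<in> {0..1} \<Longrightarrow> \<bar>q x\<bar> \<le> B"
      using compact_imp_bounded[OF compact_continuous_image[OF q compact_Icc]]
      unfolding bounded_iff by (metis imageI real_norm_def)
    have "continuous_on {0..} (\<lambda>t. q (exp (- t)))"
      by (intro continuous_on_compose2[OF q] continuous_intros) auto
    then have m: "(\<lambda>t. indicator {0..} t * q (exp (- t))) \<in> borel_measurable borel"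
      using borel_measurable_continuous_on_indicator[of "{0..}" "\<lambda>t. q (exp (- t))"] by simp
    show ?thesis
    proof (rule Bochner_Integration.integrable_bound)
      show "integrable lborel (\<lambda>t. B * ?w t)" using w by simp
      have eq: "(\<lambda>t. q (exp (- t)) * ?w t) = (\<lambda>t. (indicator {0..} t * q (exp (- t))) * ?w t)"
        by (auto simp: indicator_def fun_eq_iff)
      show "(\<lambda>t. q (exp (- t)) * ?w t) \<in> borel_measurable lborel"
        unfolding eq by (rule borel_measurable_times[OF _ meas]) (use m in simp)
      show "AE t in lborel. norm (q (exp (- t)) * ?w t) \<le> norm (B * ?w t)"
      proof (rule AE_I2)
        fix t :: real
        show "norm (q (exp (- t)) * ?w t) \<le> norm (B * ?w t)"
        proof (cases "0 \<le> t")
          case True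
          then have "\<bar>q (exp (- t))\<bar> \<le> \<bar>B\<bar>" using B[of "exp (- t)"] by simp
          then show ?thesis by (simp only: real_norm_def abs_mult) (intro mult_right_mono mult_nonneg_nonneg abs_ge_zero)
        qed simp
      qed
    qed
  qed
  define L where "L q = (LINT t|lborel. q (exp (- t)) * ?w t)" for q
  have L_pow: "L (\<lambda>x. x ^ j) = 0" for j
    using zero[of j] by (simp add: L_def set_lebesgue_integral_def mult.left_commute)
  have L_poly: "L (\<lambda>x. \<Sum>i\<le>N. c i * x ^ i) = 0" for N and c :: "nat \<Rightarrow> real"
  proof -
    have "L (\<lambda>x. \<Sum>i\<le>N. c i * x ^ i) = (\<Sum>i\<le>N. LINT t|lborel. c i * (exp (- t) ^ i * ?w t))"
      unfolding L_def sum_distrib_right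
      by (subst Bochner_Integration.integral_sum[symmetric])
         (auto intro!: intq continuous_intros simp: mult.assoc)
    also have "\<dots> = (\<Sum>i\<le>N. c i * L (\<lambda>x. x ^ i))"
      unfolding L_def by (intro sum.cong refl) (rule integral_mult_right_zero)
    finally show ?thesis using L_pow by simp
  qed
  have "\<bar>L \<phi>\<bar> \<le> 0"
  proof (rule field_le_epsilon)
    fix e :: real assume e: "e > 0"
    \<comment> \<open>the approximation error is scaled by the total variation; the summand 1 below avoids division by 0\<close>
    define I where "I = (LINT t|lborel. \<bar>?w t\<bar>)"
    have I: "I \<ge> 0" by (simp add: I_def)
    obtain p where p: "real_polynomial_function p" "\<And>x. x \<in> {0..1} \<Longrightarrow> \<bar>\<phi> x - p x\<bar> < e / (I + 1)"
      using Stone_Weierstrass_real_polynomial_function[of "{0..1::real}" \<phi> "e / (I + 1)"] cont e I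
      by auto
    obtain c N where pc: "p = (\<lambda>x. \<Sum>i\<le>N. c i * x ^ i)"
      using p(1) real_polynomial_function_iff_sum by blast
    have contp: "continuous_on {0..1} p" unfolding pc by (intro continuous_intros)
    have "L \<phi> = L \<phi> - L p" using L_poly pc by simp
    also have "\<dots> = (LINT t|lborel. \<phi> (exp (- t)) * ?w t - p (exp (- t)) * ?w t)"
      unfolding L_def by (intro Bochner_Integration.integral_diff[symmetric] intq cont contp)
    finally have "\<bar>L \<phi>\<bar> \<le> (LINT t|lborel. \<bar>\<phi> (exp (- t)) * ?w t - p (exp (- t)) * ?w t\<bar>)"
      using integral_abs_bound[of lborel "\<lambda>t. \<phi> (exp (- t)) * ?w t - p (exp (- t)) * ?w t"] by simp
    also have "\<dots> \<le> (LINT t|lborel. e / (I + 1) * \<bar>?w t\<bar>)"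
    proof (rule integral_mono)
      show "integrable lborel (\<lambda>t. \<bar>\<phi> (exp (- t)) * ?w t - p (exp (- t)) * ?w t\<bar>)"
        by (intro integrable_abs Bochner_Integration.integrable_diff intq cont contp)
      show "integrable lborel (\<lambda>t. e / (I + 1) * \<bar>?w t\<bar>)"
        using w by (intro integrable_mult_right integrable_abs)
      fix t :: real
      have "\<bar>\<phi> (exp (- t)) * ?w t - p (exp (- t)) * ?w t\<bar> = \<bar>\<phi> (exp (- t)) - p (exp (- t))\<bar> * \<bar>?w t\<bar>"
        by (simp add: left_diff_distrib[symmetric] abs_mult)
      also have "\<dots> \<le> e / (I + 1) * \<bar>?w t\<bar>"
        using p(2)[of "exp (- t)"] mult_right_mono[of "\<bar>\<phi> (exp (- t)) - p (exp (- t))\<bar>" "e / (I + 1)" "\<bar>?w t\<bar>"]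
        by (cases "0 \<le> t") auto
      finally show "\<bar>\<phi> (exp (- t)) * ?w t - p (exp (- t)) * ?w t\<bar> \<le> e / (I + 1) * \<bar>?w t\<bar>" .
    qed
    also have "\<dots> = e / (I + 1) * I" unfolding I_def by (rule integral_mult_right_zero)
    also have "\<dots> \<le> e" using I e by (simp add: field_simps)
    finally show "\<bar>L \<phi>\<bar> \<le> 0 + e" by simp
  qed
  then show ?thesis
    by (simp add: L_def set_lebesgue_integral_def mult.left_commute)
qed

text \<open>
  Otherwise a bump function supported exactly on the interval would have a positive integral
  against \<open>h\<close>.
\<close>

lemma laplace_zero_not_pos_on_interval:
  fixes h :: "real \<Rightarrow> real"
  assumes int: "set_integrable lborel {0..} (\<lambda>t. exp (- t) * h t)"
    and zero: "\<And>j::nat. (LINT t:{0..}|lborel. exp (- t) ^ j * (exp (- t) * h t)) = 0"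
    and pq: "0 \<le> p" "p < q"
  shows "\<exists>t\<in>{p<..<q}. h t \<le> 0"
proof (rule ccontr)
  assume "\<not> ?thesis"
  then have pos: "h t > 0" if "p < t" "t < q" for t using that by force
  define \<phi> where "\<phi> x = max 0 ((x - exp (- q)) * (exp (- p) - x))" for x :: real
  have phi: "\<phi> (exp (- t)) > 0" if "p < t" "t < q" for t
    using that by (auto simp: \<phi>_def less_max_iff_disj)
  have phi0: "\<phi> (exp (- t)) = 0" if "\<not> (p < t \<and> t < q)" for t
    using that pq by (auto simp: \<phi>_def max_def not_less zero_le_mult_iff mult_le_0_iff dest!: order.antisym)
  let ?g = "\<lambda>t. indicator {0..} t * (\<phi> (exp (- t)) * (exp (- t) * h t))"
  have cont: "continuous_on {0..1} \<phi>" unfolding \<phi>_def by (intro continuous_intros)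
  have "(LINT t|lborel. ?g t) = 0"
    using integral_continuous_comp_exp_eq_0[OF int zero cont] by (simp add: set_lebesgue_integral_def)
  moreover have "integrable lborel ?g"
  proof -
    have "integrable lborel (\<lambda>t. \<phi> (exp (- t)) * (indicator {0..} t * (exp (- t) * h t)))"
    proof (rule Bochner_Integration.integrable_bound)
      show "integrable lborel (\<lambda>t. exp (- p) * (indicator {0..} t * (exp (- t) * h t)))"
        using int by (simp add: set_integrable_def)
      show "(\<lambda>t. \<phi> (exp (- t)) * (indicator {0..} t * (exp (- t) * h t))) \<in> borel_measurable lborel"
      proof (rule borel_measurable_times)
        show "(\<lambda>t. \<phi> (exp (- t))) \<in> borel_measurable lborel"
          unfolding \<phi>_def by measurable
        show "(\<lambda>t. indicator {0..} t * (exp (- t) * h t)) \<in> borel_measurable lborel"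
          using int by (auto simp: set_integrable_def dest: borel_measurable_integrable)
      qed
      have "\<phi> (exp (- t)) \<le> exp (- p)" for t
      proof (cases "p < t \<and> t < q")
        case True
        have "(exp (- t) - exp (- q)) * (exp (- p) - exp (- t)) \<le> 1 * exp (- p)"
        proof (rule mult_mono)
          show "exp (- t) - exp (- q) \<le> 1"
            using True pq by (smt (verit) exp_le_one_iff exp_gt_zero)
        qed (use True in auto)
        then show ?thesis by (simp add: \<phi>_def)
      qed (simp add: phi0)
      moreover have "\<phi> x \<ge> 0" for x by (simp add: \<phi>_def)
      ultimately show "AE t in lborel. norm (\<phi> (exp (- t)) * (indicator {0..} t * (exp (- t) * h t)))
          \<le> norm (exp (- p) * (indicator {0..} t * (exp (- t) * h t)))"
        by (intro AE_I2) (auto simp: abs_mult intro!: mult_right_mono)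
    qed
    then show ?thesis by (simp add: mult.left_commute)
  qed
  moreover have "?g t \<ge> 0" for t
  proof (cases "p < t \<and> t < q")
    case True then show ?thesis using phi[of t] pos[of t] by simp
  qed (simp add: phi0)
  ultimately have "AE t in lborel. ?g t = 0"
    by (subst (asm) integral_nonneg_eq_0_iff_AE) auto
  then have "AE t in lborel. t \<notin> {p<..<q}"
  proof eventually_elim
    case (elim t)
    show ?case
    proof
      assume "t \<in> {p<..<q}"
      then show False using phi[of t] pos[of t] elim pq by auto
    qed
  qed
  then have "emeasure lborel {p<..<q} = 0"
    by (subst (asm) AE_iff_measurable[of "{p<..<q}"]) auto
  then show False using pq by simp
qed

text \<open>
  The regularity hypotheses turn a strict inequality at one point into a strict inequality on an
  interval: to the right of the point if \<open>f t > g t\<close>, to the left if \<open>f t < g t\<close>. Thus equality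
  holds pointwise, not only almost everywhere.
\<close>

lemma laplace_transform_unique_mono:
  fixes f g :: "real \<Rightarrow> real"
  assumes mono: "mono_on {0..} f" and cont: "continuous_on {0..} g"
    and f0: "\<And>t. 0 \<le> t \<Longrightarrow> 0 \<le> f t" and g0: "\<And>t. 0 \<le> t \<Longrightarrow> 0 \<le> g t"
    and eq: "\<And>u. u > 0 \<Longrightarrow> (\<integral>\<^sup>+t. ennreal (exp (- u * t) * f t) * indicator {0..} t \<partial>lborel)
                         = (\<integral>\<^sup>+t. ennreal (exp (- u * t) * g t) * indicator {0..} t \<partial>lborel)"
    and fin: "\<And>u. u > 0 \<Longrightarrow> (\<integral>\<^sup>+t. ennreal (exp (- u * t) * g t) * indicator {0..} t \<partial>lborel) < \<infinity>"
    and t: "t > 0"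
  shows "f t = g t"
proof -
  have fm: "(\<lambda>t. indicator {0..} t * f t) \<in> borel_measurable lborel"
  proof -
    have "mono (\<lambda>t. indicator {0..} t * f t)"
      using mono f0 by (auto intro!: monoI simp: mono_on_def indicator_def)
    then show ?thesis using borel_measurable_mono by auto
  qed
  have gm: "(\<lambda>t. indicator {0..} t * g t) \<in> borel_measurable lborel"
    using borel_measurable_continuous_on_indicator[OF _ cont] by simp
  have main: "integrable lborel (\<lambda>t. indicator {0..} t * (exp (- u * t) * k t))
     \<and> (LINT t|lborel. indicator {0..} t * (exp (- u * t) * k t)) =
        enn2real (\<integral>\<^sup>+t. ennreal (exp (- u * t) * k t) * indicator {0..} t \<partial>lborel)"
    if u: "u > 0" and k: "(\<lambda>t. indicator {0..} t * k t) \<in> borel_measurable lborel"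
      "\<And>t. 0 \<le> t \<Longrightarrow> 0 \<le> k t"
      "(\<integral>\<^sup>+t. ennreal (exp (- u * t) * k t) * indicator {0..} t \<partial>lborel) < \<infinity>"
    for u and k :: "real \<Rightarrow> real"
  proof -
    have m: "(\<lambda>t. indicator {0..} t * (exp (- u * t) * k t)) \<in> borel_measurable lborel"
    proof -
      have "(\<lambda>t. exp (- u * t) * (indicator {0..} t * k t)) \<in> borel_measurable lborel"
        by (rule borel_measurable_times[OF _ k(1)]) simp
      then show ?thesis by (simp add: mult.left_commute)
    qed
    have e: "(\<integral>\<^sup>+t. ennreal (indicator {0..} t * (exp (- u * t) * k t)) \<partial>lborel)
       = (\<integral>\<^sup>+t. ennreal (exp (- u * t) * k t) * indicator {0..} t \<partial>lborel)"
      by (intro nn_integral_cong) (auto simp: indicator_def)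
    have nn: "AE t in lborel. 0 \<le> indicator {0..} t * (exp (- u * t) * k t)"
      using k(2) by (intro AE_I2) (auto simp: indicator_def)
    show ?thesis
      using integrableI_nonneg[OF m nn] integral_eq_nn_integral[OF m nn] k(3) unfolding e by simp
  qed
  let ?h = "\<lambda>t. f t - g t"
  have fi: "(\<integral>\<^sup>+t. ennreal (exp (- u * t) * f t) * indicator {0..} t \<partial>lborel) < \<infinity>" if "u > 0" for u
    using eq[OF that] fin[OF that] by simp
  have int: "set_integrable lborel {0..} (\<lambda>t. exp (- t) * ?h t)"
    using main[OF zero_less_one fm f0 fi[OF zero_less_one]] main[OF zero_less_one gm g0 fin[OF zero_less_one]]
      Bochner_Integration.integrable_diff[of lborel "\<lambda>t. indicator {0..} t * (exp (- t) * f t)" "\<lambda>t. indicator {0..} t * (exp (- t) * g t)"]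
    unfolding set_integrable_def by (simp add: algebra_simps)
  have zero: "(LINT t:{0..}|lborel. exp (- t) ^ j * (exp (- t) * ?h t)) = 0" for j :: nat
  proof -
    define u where "u = real j + 1"
    have u: "u > 0" by (simp add: u_def)
    have e: "exp (- t) ^ j * (exp (- t) * c) = exp (- u * t) * c" for t c :: real
      by (simp add: u_def exp_of_nat_mult[symmetric] exp_add[symmetric] mult.assoc[symmetric] algebra_simps)
    have "(LINT t:{0..}|lborel. exp (- t) ^ j * (exp (- t) * ?h t)) =
          (LINT t|lborel. indicator {0..} t * (exp (- u * t) * f t) - indicator {0..} t * (exp (- u * t) * g t))"
      unfolding set_lebesgue_integral_def by (intro Bochner_Integration.integral_cong refl) (simp only: e, simp add: algebra_simps)
    also have "\<dots> = 0"
      using main[OF u fm f0 fi[OF u]] main[OF u gm g0 fin[OF u]] eq[OF u]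
      by (subst Bochner_Integration.integral_diff) auto
    finally show ?thesis .
  qed
  have int': "set_integrable lborel {0..} (\<lambda>t. exp (- t) * - ?h t)"
    using int unfolding set_integrable_def mult_minus_right scaleR_minus_right
    by (rule Bochner_Integration.integrable_minus)
  have zero': "(LINT t:{0..}|lborel. exp (- t) ^ j * (exp (- t) * - ?h t)) = 0" for j :: nat
    using zero[of j] unfolding set_lebesgue_integral_def mult_minus_right scaleR_minus_right
    by (simp only: Bochner_Integration.integral_minus neg_equal_0_iff_equal)
  have gt: "isCont g t" using cont t
    by (intro continuous_on_interior[OF cont]) auto
  show ?thesis
  proof (rule ccontr)
    assume "f t \<noteq> g t"
    then consider "g t < f t" | "f t < g t" by linarith
    then show False
    proof cases
      case 1
      then have "eventually (\<lambda>x. g x < f t) (at t)"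
        using gt by (intro order_tendstoD) (auto simp: isCont_def)
      then obtain d where d: "d > 0" "\<And>x. x \<noteq> t \<Longrightarrow> dist x t < d \<Longrightarrow> g x < f t"
        unfolding eventually_at by blast
      obtain x where x: "x \<in> {t<..<t + d}" "?h x \<le> 0"
        using laplace_zero_not_pos_on_interval[OF int zero, of t "t + d"] t d by auto
      have "f t \<le> f x" using mono x t by (auto simp: mono_on_def)
      moreover have "g x < f t" using d(2)[of x] x by (auto simp: dist_real_def)
      ultimately show False using x by auto
    next
      case 2
      then have "eventually (\<lambda>x. f t < g x) (at t)"
        using gt by (intro order_tendstoD) (auto simp: isCont_def)
      then obtain d where d: "d > 0" "\<And>x. x \<noteq> t \<Longrightarrow> dist x t < d \<Longrightarrow> f t < g x"
        unfolding eventually_at by blast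
      obtain x where x: "x \<in> {max 0 (t - d)<..<t}" "- ?h x \<le> 0"
        using laplace_zero_not_pos_on_interval[OF int' zero', of "max 0 (t - d)" t] t d by auto
      have "f x \<le> f t" using mono x t by (auto simp: mono_on_def)
      moreover have "f t < g x" using d(2)[of x] x by (auto simp: dist_real_def)
      ultimately show False using x by auto
    qed
  qed
qed

section \<open>Two Laplace integrals\<close>

lemma nn_integral_powr_exp:
  fixes p u :: real
  assumes "0 < p" "0 < u"
  shows "(\<integral>\<^sup>+t. ennreal (t powr (p - 1) * exp (- u * t)) * indicator {0..} t \<partial>lborel)
         = ennreal (Gamma p / u powr p)"
proof -
  define g where "g t = ennreal (indicator {0..} (u * t) * (u * t) powr (p - 1) / exp (u * t))" for t
  have [measurable]: "g \<in> borel_measurable borel" unfolding g_def by measurable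
  have "(\<integral>\<^sup>+t. g t \<partial>lborel) = ennreal \<bar>1 / u\<bar> * (\<integral>\<^sup>+t. g (0 + 1 / u * t) \<partial>lborel)"
    using assms by (intro nn_integral_real_affine) auto
  also have "(\<integral>\<^sup>+t. g (0 + 1 / u * t) \<partial>lborel) = ennreal (Gamma p)"
    using assms Gamma_conv_nn_integral_real[of p] by (simp add: g_def)
  finally have g: "(\<integral>\<^sup>+t. g t \<partial>lborel) = ennreal (Gamma p / u)"
    using assms by (simp add: ennreal_mult'[symmetric])
  have "(\<integral>\<^sup>+t. ennreal (t powr (p - 1) * exp (- u * t)) * indicator {0..} t \<partial>lborel)
      = (\<integral>\<^sup>+t. ennreal (u powr (1 - p)) * g t \<partial>lborel)"
  proof (rule nn_integral_cong)
    fix t :: real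
    show "ennreal (t powr (p - 1) * exp (- u * t)) * indicator {0..} t = ennreal (u powr (1 - p)) * g t"
    proof (cases "0 \<le> t")
      case True
      have "u powr (1 - p) * u powr (p - 1) = 1" using assms by (simp add: powr_add[symmetric])
      then have "t powr (p - 1) * exp (- u * t) = u powr (1 - p) * ((u * t) powr (p - 1) / exp (u * t))"
        using True assms by (simp add: powr_mult exp_minus field_simps)
      then show ?thesis using True assms by (simp add: g_def ennreal_mult'[symmetric] del: ennreal_mult')
    next
      case False
      then have "\<not> 0 \<le> u * t" using assms by (simp add: zero_le_mult_iff)
      then show ?thesis using False by (simp add: g_def)
    qed
  qed
  also have "\<dots> = ennreal (u powr (1 - p) * (Gamma p / u))"
    using assms by (subst nn_integral_cmult) (auto simp: g ennreal_mult'[symmetric])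
  also have "u powr (1 - p) * (Gamma p / u) = Gamma p / u powr p"
    using assms by (simp add: powr_diff)
  finally show ?thesis .
qed

lemma nn_integral_exp_atLeast:
  fixes u c :: real
  assumes "0 < u"
  shows "(\<integral>\<^sup>+t. ennreal (exp (- u * t)) * indicator {c..} t \<partial>lborel) = ennreal (exp (- u * c) / u)"
proof -
  have "((\<lambda>t. - exp (- u * t) / u) \<longlongrightarrow> - 0 / u) at_top"
    using assms
    by (intro tendsto_intros filterlim_compose[OF exp_at_bot] filterlim_tendsto_neg_mult_at_bot[where c = "- u"]
        filterlim_ident) auto
  then have "((\<lambda>t. - exp (- u * t) / u) \<longlongrightarrow> 0) at_top" by simp
  moreover have "((\<lambda>t. - exp (- u * t) / u) has_real_derivative exp (- u * t)) (at t)" for t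
    using assms by (auto intro!: derivative_eq_intros simp: field_simps)
  ultimately have "(\<integral>\<^sup>+t. ennreal (exp (- u * t)) * indicator {c..} t \<partial>lborel)
      = ennreal (0 - (- exp (- u * c) / u))"
    by (intro nn_integral_FTC_atLeast) auto
  then show ?thesis by simp
qed

section \<open>Dyadic approximation from above\<close>

text \<open>
  The smallest multiple of \<open>2 ^ (- n)\<close> strictly above \<open>x \<ge> 0\<close>. Being strictly above matters for
  limits from the right; taking powers of two makes the sequence decreasing.
\<close>

definition dyadic_above :: "nat \<Rightarrow> real \<Rightarrow> real" where
  "dyadic_above n x = real (Suc (nat \<lfloor>2 ^ n * x\<rfloor>)) / 2 ^ n"

lemma dyadic_above_gt: "x < dyadic_above n x"
proof -
  have "2 ^ n * x < real (Suc (nat \<lfloor>2 ^ n * x\<rfloor>))" by linarith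
  then show ?thesis by (simp add: dyadic_above_def field_simps)
qed

lemma dyadic_above_le: "0 \<le> x \<Longrightarrow> dyadic_above n x \<le> x + (1 / 2) ^ n"
proof -
  assume "0 \<le> x"
  then have "0 \<le> 2 ^ n * x" by simp
  then have "real (Suc (nat \<lfloor>2 ^ n * x\<rfloor>)) \<le> 2 ^ n * x + 1" by linarith
  then show ?thesis by (simp add: dyadic_above_def field_simps power_divide)
qed

lemma dyadic_above_pos: "0 < dyadic_above n x"
  by (simp add: dyadic_above_def del: of_nat_Suc)

lemma dyadic_above_tendsto:
  assumes "0 \<le> x"
  shows "(\<lambda>n. dyadic_above n x) \<longlonglongrightarrow> x"
proof (rule tendsto_sandwich)
  show "(\<lambda>n. x) \<longlonglongrightarrow> x" by simp
  show "(\<lambda>n. x + (1 / 2) ^ n) \<longlonglongrightarrow> x"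
    using tendsto_add[OF tendsto_const LIMSEQ_power_zero[of "1 / 2 :: real"], of x] by simp
  show "\<forall>\<^sub>F n in sequentially. x \<le> dyadic_above n x"
    using dyadic_above_gt[of x] by (intro always_eventually allI less_imp_le)
  show "\<forall>\<^sub>F n in sequentially. dyadic_above n x \<le> x + (1 / 2) ^ n"
    using dyadic_above_le[OF assms] by (intro always_eventually allI)
qed

lemma dyadic_above_decseq:
  assumes "0 \<le> x"
  shows "decseq (\<lambda>n. dyadic_above n x)"
proof (rule decseq_SucI)
  fix n
  have "0 \<le> 2 ^ n * x" using assms by simp
  then have "\<lfloor>2 ^ Suc n * x\<rfloor> + 1 \<le> 2 * (\<lfloor>2 ^ n * x\<rfloor> + 1)" by (simp add: mult.assoc) linarith
  moreover have "0 \<le> \<lfloor>2 ^ Suc n * x\<rfloor>" "0 \<le> \<lfloor>2 ^ n * x\<rfloor>" using assms by simp_all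
  moreover have "Suc (nat a) \<le> 2 * Suc (nat b)" if "a + 1 \<le> 2 * (b + 1)" "0 \<le> a" "0 \<le> b" for a b :: int
    using that by (elim nonneg_int_cases) auto
  ultimately have "Suc (nat \<lfloor>2 ^ Suc n * x\<rfloor>) \<le> 2 * Suc (nat \<lfloor>2 ^ n * x\<rfloor>)" by blast
  then have "real (Suc (nat \<lfloor>2 ^ Suc n * x\<rfloor>)) \<le> 2 * real (Suc (nat \<lfloor>2 ^ n * x\<rfloor>))"
    by (metis of_nat_le_iff of_nat_mult of_nat_numeral)
  then show "dyadic_above (Suc n) x \<le> dyadic_above n x"
    by (simp add: dyadic_above_def field_simps del: of_nat_Suc)
qed

section \<open>Moments of the inverse stable subordinator\<close>

locale stable_subordinator_space = prob_space M
  for M :: "'w measure" +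
  fixes \<alpha> :: real and H :: "real \<Rightarrow> 'w \<Rightarrow> real"
  assumes stable: "stable_subordinator M \<alpha> H" and index_pos: "0 < \<alpha>"
begin

lemma measurable_H [measurable]: "0 \<le> t \<Longrightarrow> H t \<in> borel_measurable M"
  using stable by (auto simp: stable_subordinator_def levy_process_def)

lemma H_mono: "w \<in> space M \<Longrightarrow> 0 \<le> s \<Longrightarrow> s \<le> t \<Longrightarrow> H s w \<le> H t w"
  using stable by (auto simp: stable_subordinator_def mono_on_def)

lemma AE_H_nonneg: "AE w in M. \<forall>t\<ge>0. 0 \<le> H t w"
proof -
  have "AE w in M. H 0 w = 0"
    using stable by (auto simp: stable_subordinator_def levy_process_def)
  moreover have "AE w in M. w \<in> space M" by simp
  ultimately show ?thesis
    by eventually_elim (use H_mono in force)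
qed

lemma nn_integral_exp_H:
  assumes "0 \<le> t" "0 < u"
  shows "(\<integral>\<^sup>+w. ennreal (exp (- u * H t w)) \<partial>M) = ennreal (exp (- t * u powr \<alpha>))"
proof -
  have eq: "integral\<^sup>L M (\<lambda>w. exp (- u * H t w)) = exp (- t * u powr \<alpha>)"
    using stable assms by (simp add: stable_subordinator_def)
  have "integrable M (\<lambda>w. exp (- u * H t w))"
    using not_integrable_integral_eq[of M "\<lambda>w. exp (- u * H t w)"] eq by force
  then show ?thesis using eq by (subst nn_integral_eq_integral) auto
qed

text \<open>
  The variables \<open>exp (- H n)\<close> have the summable means \<open>exp (- n)\<close>, so they tend to 0 almost surely.
\<close>

lemma AE_H_unbounded: "AE w in M. \<forall>t. \<exists>\<tau>>0. t < H \<tau> w"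
proof -
  have "(\<integral>\<^sup>+w. (\<Sum>n. ennreal (exp (- 1 * H (real (Suc n)) w))) \<partial>M)
      = (\<Sum>n. \<integral>\<^sup>+w. ennreal (exp (- 1 * H (real (Suc n)) w)) \<partial>M)"
    by (intro nn_integral_suminf) measurable
  also have "\<dots> = (\<Sum>n. ennreal (exp (- 1) * exp (- 1) ^ n))"
    by (intro suminf_cong, subst nn_integral_exp_H)
       (auto simp: exp_of_nat_mult[symmetric] exp_add[symmetric] algebra_simps)
  also have "\<dots> = ennreal (\<Sum>n. exp (- 1) * exp (- 1) ^ n)"
    by (intro suminf_ennreal2 summable_mult summable_geometric) auto
  finally have "(\<integral>\<^sup>+w. (\<Sum>n. ennreal (exp (- 1 * H (real (Suc n)) w))) \<partial>M) \<noteq> \<infinity>"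
    by simp
  then have "AE w in M. (\<Sum>n. ennreal (exp (- 1 * H (real (Suc n)) w))) \<noteq> \<infinity>"
    by (intro nn_integral_PInf_AE) measurable
  then show ?thesis
  proof eventually_elim
    case (elim w)
    have "summable (\<lambda>n. exp (- H (real (Suc n)) w))"
      using elim by (intro summable_suminf_not_top) auto
    then have "(\<lambda>n. exp (- H (real (Suc n)) w)) \<longlonglongrightarrow> 0" by (rule summable_LIMSEQ_zero)
    then have "\<exists>n. exp (- H (real (Suc n)) w) < exp (- t)" for t
      by (intro eventually_happens'[OF sequentially_bot order_tendstoD(2)]) auto
    then show ?case
      by (metis exp_less_cancel_iff neg_less_iff_less of_nat_0_less_iff zero_less_Suc)
  qed
qed

lemma H_right_limit:
  assumes "w \<in> space M" "0 \<le> t"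
  shows "(\<lambda>n. H (dyadic_above n t) w) \<longlonglongrightarrow> H t w"
proof -
  have "((\<lambda>u. H u w) \<longlongrightarrow> H t w) (at_right t)"
    using stable assms by (auto simp: stable_subordinator_def levy_process_def continuous_within)
  moreover have "filterlim (\<lambda>n. dyadic_above n t) (at_right t) sequentially"
    using dyadic_above_tendsto[OF assms(2)] dyadic_above_gt[of t]
    by (simp add: filterlim_at less_imp_neq[THEN not_sym])
  ultimately show ?thesis by (rule filterlim_compose)
qed

text \<open>
  Right-continuity makes \<open>H\<close> the pointwise limit of step functions in time.
\<close>

lemma measurable_H_joint:
  "(\<lambda>(w, \<tau>). H (max 0 \<tau>) w) \<in> borel_measurable (M \<Otimes>\<^sub>M borel)"
proof (rule borel_measurable_LIMSEQ_real[where u = "\<lambda>n (w, \<tau>). H (dyadic_above n (max 0 \<tau>)) w"])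
  show "(\<lambda>(w, \<tau>). H (dyadic_above n (max 0 \<tau>)) w) \<in> borel_measurable (M \<Otimes>\<^sub>M borel)" for n :: nat
  proof -
    have "(\<lambda>q. (\<lambda>k q. H (real (Suc k) / 2 ^ n) (fst q)) (nat \<lfloor>2 ^ n * max 0 (snd q)\<rfloor>) q)
          \<in> borel_measurable (M \<Otimes>\<^sub>M (borel :: real measure))"
    proof (rule measurable_compose_countable[where f = "\<lambda>k q. H (real (Suc k) / 2 ^ n) (fst q)"
            and g = "\<lambda>q. nat \<lfloor>2 ^ n * max 0 (snd q)\<rfloor>"])
      show "(\<lambda>q. H (real (Suc k) / 2 ^ n) (fst q)) \<in> borel_measurable (M \<Otimes>\<^sub>M (borel :: real measure))" for k
        by (rule measurable_compose[OF measurable_fst]) measurable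
    qed measurable
    then show ?thesis
      by (simp add: dyadic_above_def split_beta')
  qed
next
  show "(\<lambda>n. case q of (w, \<tau>) \<Rightarrow> H (dyadic_above n (max 0 \<tau>)) w)
    \<longlonglongrightarrow> (case q of (w, \<tau>) \<Rightarrow> H (max 0 \<tau>) w)"
    if "q \<in> space (M \<Otimes>\<^sub>M (borel :: real measure))" for q
    using that by (auto simp: space_pair_measure intro!: H_right_limit)
qed

text \<open>
  The inverse process separates the times with \<open>H \<tau> \<le> t\<close> from those with \<open>H \<tau> > t\<close>; which side
  the boundary point belongs to is irrelevant for integrals over \<open>\<tau>\<close>. The level has to be exceeded
  at some time, since the infimum of the empty set is an arbitrary number.
\<close>

lemma inverse_process_level_set:
  assumes w: "w \<in> space M" and ex: "\<exists>\<tau>>0. t < H \<tau> w"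
  shows "0 \<le> inverse_process H t w"
    and "\<And>\<tau>. 0 < \<tau> \<Longrightarrow> \<tau> < inverse_process H t w \<Longrightarrow> H \<tau> w \<le> t"
    and "\<And>\<tau>. 0 < \<tau> \<Longrightarrow> inverse_process H t w < \<tau> \<Longrightarrow> t < H \<tau> w"
proof -
  let ?S = "{\<tau>. \<tau> > 0 \<and> H \<tau> w > t}"
  have ne: "?S \<noteq> {}" and bdd: "bdd_below ?S" using ex by (auto intro!: bdd_belowI[of _ 0])
  show "0 \<le> inverse_process H t w"
    unfolding inverse_process_def by (rule cInf_greatest[OF ne]) auto
  show "H \<tau> w \<le> t" if "0 < \<tau>" "\<tau> < inverse_process H t w" for \<tau>
    using that cInf_lower[OF _ bdd, of \<tau>] unfolding inverse_process_def by force
  show "t < H \<tau> w" if "0 < \<tau>" "inverse_process H t w < \<tau>" for \<tau>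
  proof -
    have "Inf ?S < \<tau>" using that by (simp only: inverse_process_def)
    from cInf_lessD[OF ne this] obtain \<sigma> where "0 < \<sigma>" "t < H \<sigma> w" "\<sigma> < \<tau>" by auto
    then show ?thesis using H_mono[OF w, of \<sigma> \<tau>] by linarith
  qed
qed

lemma AE_inverse_process_nonneg: "AE w in M. 0 \<le> inverse_process H t w"
proof -
  have "AE w in M. w \<in> space M" by simp
  with AE_H_unbounded show ?thesis
    by eventually_elim (rule inverse_process_level_set(1); simp)
qed

text \<open>
  The integrand of the layer cake formula \<open>E t ^ (m + 1) = \<integral> (m + 1) * \<tau> ^ m * 1 (H \<tau> \<le> t) d\<tau>\<close>,
  as a function of the pair \<open>(w, \<tau>)\<close>. The time is cut off at 0 because the paths are only controlled
  at non-negative times.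
\<close>

definition layer :: "nat \<Rightarrow> real \<Rightarrow> 'w \<times> real \<Rightarrow> ennreal" where
  "layer m t q = ennreal (real (Suc m) * snd q ^ m) * indicator {0<..} (snd q) *
     (if H (max 0 (snd q)) (fst q) \<le> t then 1 else 0)"

lemma measurable_layer [measurable]: "layer m t \<in> borel_measurable (M \<Otimes>\<^sub>M borel)"
  using measurable_H_joint unfolding layer_def split_beta' by measurable

lemma inverse_process_power_eq_layers:
  assumes w: "w \<in> space M" and ex: "\<exists>\<tau>>0. t < H \<tau> w"
  shows "ennreal (inverse_process H t w ^ Suc m) = (\<integral>\<^sup>+\<tau>. layer m t (w, \<tau>) \<partial>lborel)"
proof -
  let ?E = "inverse_process H t w"
  note lev = inverse_process_level_set[OF assms]
  have "(\<integral>\<^sup>+\<tau>. layer m t (w, \<tau>) \<partial>lborel)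
      = (\<integral>\<^sup>+\<tau>. ennreal (real (Suc m) * \<tau> ^ m) * indicator {0..?E} \<tau> \<partial>lborel)"
  proof (rule nn_integral_cong_AE)
    show "AE \<tau> in lborel. layer m t (w, \<tau>) = ennreal (real (Suc m) * \<tau> ^ m) * indicator {0..?E} \<tau>"
      using AE_lborel_singleton[of 0] AE_lborel_singleton[of ?E]
    proof eventually_elim
      case (elim \<tau>)
      then show ?case
        using lev(2)[of \<tau>] lev(3)[of \<tau>]
        by (cases "0 < \<tau>"; cases "\<tau> < ?E") (auto simp: layer_def indicator_def)
    qed
  qed
  also have "\<dots> = ennreal (?E ^ Suc m - 0 ^ Suc m)"
    using lev(1) by (intro nn_integral_FTC_Icc) (auto intro!: derivative_eq_intros simp del: power_Suc)
  finally show ?thesis by simp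
qed

lemma nn_integral_inverse_process_eq_layers:
  "(\<integral>\<^sup>+w. ennreal (inverse_process H t w ^ Suc m) \<partial>M) = (\<integral>\<^sup>+q. layer m t q \<partial>(M \<Otimes>\<^sub>M lborel))"
proof -
  have "AE w in M. w \<in> space M" by simp
  with AE_H_unbounded have "AE w in M. ennreal (inverse_process H t w ^ Suc m) = (\<integral>\<^sup>+\<tau>. layer m t (w, \<tau>) \<partial>lborel)"
    by eventually_elim (rule inverse_process_power_eq_layers; blast)
  then have "(\<integral>\<^sup>+w. ennreal (inverse_process H t w ^ Suc m) \<partial>M) = (\<integral>\<^sup>+w. \<integral>\<^sup>+\<tau>. layer m t (w, \<tau>) \<partial>lborel \<partial>M)"
    by (rule nn_integral_cong_AE)
  also have "\<dots> = (\<integral>\<^sup>+q. layer m t q \<partial>(M \<Otimes>\<^sub>M lborel))"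
    by (rule lborel.nn_integral_fst) measurable
  finally show ?thesis .
qed

text \<open>
  Tonelli allows one to integrate over the level \<open>t\<close> first, which yields \<open>exp (- u * H \<tau>) / u\<close>. Its
  expectation is \<open>exp (- \<tau> * u powr \<alpha>) / u\<close>, and the remaining integral over \<open>\<tau>\<close> is a Gamma integral.
\<close>

lemma laplace_moment_inverse_process:
  assumes u: "0 < u"
  shows "(\<integral>\<^sup>+t. ennreal (exp (- u * t)) * (\<integral>\<^sup>+w. ennreal (inverse_process H t w ^ Suc m) \<partial>M)
            * indicator {0..} t \<partial>lborel)
         = ennreal (fact (Suc m) / u powr (real (Suc m) * \<alpha> + 1))"
proof -
  interpret P: pair_sigma_finite M "lborel :: real measure" ..
  interpret Q: pair_sigma_finite "lborel :: real measure" "M \<Otimes>\<^sub>M (lborel :: real measure)"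
    by (rule pair_sigma_finite.intro[OF lborel.sigma_finite_measure_axioms
          sigma_finite_pair_measure[OF sigma_finite_measure_axioms lborel.sigma_finite_measure_axioms]])
  define G where "G q = ennreal (real (Suc m) * snd q ^ m) * indicator {0<..} (snd q)" for q :: "'w \<times> real"
  define h where "h q = H (max 0 (snd q)) (fst q)" for q
  have "h = (\<lambda>(w, \<tau>). H (max 0 \<tau>) w)" by (simp add: h_def fun_eq_iff)
  then have [measurable]: "h \<in> borel_measurable (M \<Otimes>\<^sub>M borel)"
    using measurable_H_joint by (simp only:)
  have [measurable]: "G \<in> borel_measurable (M \<Otimes>\<^sub>M borel)" unfolding G_def by measurable
  have lay: "layer m t q = G q * (if h q \<le> t then 1 else 0)" for t q
    by (simp add: layer_def G_def h_def)
  let ?f = "\<lambda>t q. ennreal (exp (- u * t)) * indicator {0..} t * (G q * (if h q \<le> t then 1 else 0))"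
  have "(\<integral>\<^sup>+t. ennreal (exp (- u * t)) * (\<integral>\<^sup>+w. ennreal (inverse_process H t w ^ Suc m) \<partial>M)
            * indicator {0..} t \<partial>lborel) = (\<integral>\<^sup>+t. \<integral>\<^sup>+q. ?f t q \<partial>(M \<Otimes>\<^sub>M lborel) \<partial>lborel)"
    unfolding nn_integral_inverse_process_eq_layers lay
    by (intro nn_integral_cong, subst nn_integral_cmult) (auto simp: ac_simps)
  also have "\<dots> = (\<integral>\<^sup>+q. \<integral>\<^sup>+t. ?f t q \<partial>lborel \<partial>(M \<Otimes>\<^sub>M lborel))"
    by (intro Q.Fubini'[symmetric]) measurable
  also have "\<dots> = (\<integral>\<^sup>+q. G q * ennreal (exp (- u * h q) / u) \<partial>(M \<Otimes>\<^sub>M lborel))"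
  proof (rule nn_integral_cong_AE)
    have "AE q in M \<Otimes>\<^sub>M lborel. 0 \<le> h q"
    proof (rule P.AE_pair_measure)
      show "{q \<in> space (M \<Otimes>\<^sub>M lborel). 0 \<le> h q} \<in> sets (M \<Otimes>\<^sub>M lborel)" by measurable
      show "AE w in M. AE \<tau> in lborel. 0 \<le> h (w, \<tau>)"
        using AE_H_nonneg by eventually_elim (auto simp: h_def)
    qed
    then show "AE q in M \<Otimes>\<^sub>M lborel. (\<integral>\<^sup>+t. ?f t q \<partial>lborel) = G q * ennreal (exp (- u * h q) / u)"
    proof eventually_elim
      case (elim q)
      have "(\<integral>\<^sup>+t. ?f t q \<partial>lborel) = (\<integral>\<^sup>+t. G q * (ennreal (exp (- u * t)) * indicator {h q..} t) \<partial>lborel)"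
        using elim by (intro nn_integral_cong) (auto simp: indicator_def mult.commute)
      then show ?case using u by (simp add: nn_integral_cmult nn_integral_exp_atLeast[simplified])
    qed
  qed
  also have "\<dots> = (\<integral>\<^sup>+\<tau>. \<integral>\<^sup>+w. G (w, \<tau>) * ennreal (exp (- u * h (w, \<tau>)) / u) \<partial>M \<partial>lborel)"
    by (rule P.nn_integral_snd[symmetric]) measurable
  also have "\<dots> = (\<integral>\<^sup>+\<tau>. ennreal (real (Suc m) / u) *
        (ennreal (\<tau> powr (real (Suc m) - 1) * exp (- (u powr \<alpha>) * \<tau>)) * indicator {0..} \<tau>) \<partial>lborel)"
  proof (rule nn_integral_cong_AE)
    show "AE \<tau> in lborel. (\<integral>\<^sup>+w. G (w, \<tau>) * ennreal (exp (- u * h (w, \<tau>)) / u) \<partial>M) =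
      ennreal (real (Suc m) / u) *
        (ennreal (\<tau> powr (real (Suc m) - 1) * exp (- (u powr \<alpha>) * \<tau>)) * indicator {0..} \<tau>)"
      using AE_lborel_singleton[of 0]
    proof eventually_elim
      case (elim \<tau>)
      show ?case
      proof (cases "0 < \<tau>")
        case True
        have "(\<integral>\<^sup>+w. G (w, \<tau>) * ennreal (exp (- u * h (w, \<tau>)) / u) \<partial>M)
            = (\<integral>\<^sup>+w. ennreal (real (Suc m) * \<tau> ^ m / u) * ennreal (exp (- u * H \<tau> w)) \<partial>M)"
          using True u by (intro nn_integral_cong) (simp add: G_def h_def ennreal_mult'[symmetric])
        also have "\<dots> = ennreal (real (Suc m) * \<tau> ^ m / u) * ennreal (exp (- \<tau> * u powr \<alpha>))"
          using True u by (subst nn_integral_cmult) (auto simp: nn_integral_exp_H[simplified])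
        finally show ?thesis
          using True u by (simp add: ennreal_mult'[symmetric] powr_realpow mult_ac)
      next
        case False
        then show ?thesis using elim by (simp add: G_def)
      qed
    qed
  qed
  also have "\<dots> = ennreal (real (Suc m) / u) * ennreal (Gamma (real (Suc m)) / (u powr \<alpha>) powr real (Suc m))"
    using u by (subst nn_integral_cmult) (simp_all only: nn_integral_powr_exp of_nat_0_less_iff powr_gt_zero, auto)
  also have "\<dots> = ennreal (fact (Suc m) / u powr (real (Suc m) * \<alpha> + 1))"
    using u Gamma_fact[of m, where 'a = real]
    by (simp add: ennreal_mult'[symmetric] powr_powr powr_add algebra_simps)
  finally show ?thesis .
qed

lemma nn_integral_inverse_process_mono:
  assumes "t \<le> t'"
  shows "(\<integral>\<^sup>+w. ennreal (inverse_process H t w ^ Suc m) \<partial>M) \<le> (\<integral>\<^sup>+w. ennreal (inverse_process H t' w ^ Suc m) \<partial>M)"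
  unfolding nn_integral_inverse_process_eq_layers
  using assms by (intro nn_integral_mono) (auto simp: layer_def indicator_def)

text \<open>
  The moment is increasing in \<open>t\<close> and its Laplace transform is finite.
\<close>

lemma nn_integral_inverse_process_finite:
  assumes "0 \<le> t"
  shows "(\<integral>\<^sup>+w. ennreal (inverse_process H t w ^ Suc m) \<partial>M) < \<infinity>"
proof -
  let ?F = "\<lambda>t. (\<integral>\<^sup>+w. ennreal (inverse_process H t w ^ Suc m) \<partial>M)"
  have "?F t * ennreal (exp (- t)) = ?F t * (\<integral>\<^sup>+s. ennreal (exp (- 1 * s)) * indicator {t..} s \<partial>lborel)"
    by (subst nn_integral_exp_atLeast) auto
  also have "\<dots> = (\<integral>\<^sup>+s. ?F t * (ennreal (exp (- 1 * s)) * indicator {t..} s) \<partial>lborel)"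
    by (intro nn_integral_cmult[symmetric]) measurable
  also have "\<dots> \<le> (\<integral>\<^sup>+s. ennreal (exp (- 1 * s)) * ?F s * indicator {0..} s \<partial>lborel)"
  proof (rule nn_integral_mono)
    fix s :: real
    show "?F t * (ennreal (exp (- 1 * s)) * indicator {t..} s) \<le> ennreal (exp (- 1 * s)) * ?F s * indicator {0..} s"
      using nn_integral_inverse_process_mono[of t s m] assms
      by (cases "t \<le> s") (auto simp: mult.commute intro!: mult_left_mono)
  qed
  also have "\<dots> < \<infinity>"
    by (subst laplace_moment_inverse_process) auto
  finally show ?thesis by (auto simp: ennreal_mult_less_top)
qed

text \<open>
  The function \<open>t powr e\<close>, \<open>e = (m + 1) * \<alpha>\<close>, with the stated constant has the same Laplace transform
  as the moment. Uniqueness covers \<open>t > 0\<close>; at \<open>t = 0\<close> the moment is squeezed between 0 and its values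
  at positive \<open>t\<close>, which tend to 0.
\<close>

lemma nn_integral_inverse_process:
  assumes t: "0 \<le> t"
  shows "(\<integral>\<^sup>+w. ennreal (inverse_process H t w ^ Suc m) \<partial>M)
         = ennreal (fact (Suc m) / Gamma (real (Suc m) * \<alpha> + 1) * (t powr \<alpha>) ^ Suc m)"
proof -
  define F where "F t = (\<integral>\<^sup>+w. ennreal (inverse_process H t w ^ Suc m) \<partial>M)" for t
  define f where "f t = enn2real (F t)" for t
  define e where "e = real (Suc m) * \<alpha>"
  define c where "c = fact (Suc m) / Gamma (e + 1)"
  define g where "g t = c * t powr e" for t
  have epos: "e > 0" using index_pos by (simp add: e_def)
  have Gpos: "Gamma (e + 1) > 0" using epos by (intro Gamma_real_pos) auto
  then have cpos: "c > 0" by (simp add: c_def)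
  have Ff: "F t = ennreal (f t)" if "0 \<le> t" for t
    using nn_integral_inverse_process_finite[OF that, of m] by (simp add: f_def F_def)
  have fmono: "f s \<le> f t" if "0 \<le> s" "s \<le> t" for s t
    using nn_integral_inverse_process_mono[OF that(2), of m] nn_integral_inverse_process_finite[of t m] that
    unfolding f_def F_def by (intro enn2real_mono) auto
  have lapg: "(\<integral>\<^sup>+t. ennreal (exp (- u * t) * g t) * indicator {0..} t \<partial>lborel)
        = ennreal (fact (Suc m) / u powr (e + 1))" if "u > 0" for u
  proof -
    have "(\<integral>\<^sup>+t. ennreal (exp (- u * t) * g t) * indicator {0..} t \<partial>lborel)
        = (\<integral>\<^sup>+t. ennreal c * (ennreal (t powr (e + 1 - 1) * exp (- u * t)) * indicator {0..} t) \<partial>lborel)"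
      using cpos by (intro nn_integral_cong) (auto simp: g_def ennreal_mult'[symmetric] mult_ac indicator_def)
    also have "\<dots> = ennreal c * ennreal (Gamma (e + 1) / u powr (e + 1))"
      using that epos nn_integral_powr_exp[of "e + 1" u] by (subst nn_integral_cmult) auto
    also have "\<dots> = ennreal (fact (Suc m) / u powr (e + 1))"
      using cpos Gpos by (simp add: ennreal_mult'[symmetric] c_def)
    finally show ?thesis .
  qed
  have lapf: "(\<integral>\<^sup>+t. ennreal (exp (- u * t) * f t) * indicator {0..} t \<partial>lborel)
        = ennreal (fact (Suc m) / u powr (e + 1))" if "u > 0" for u
  proof -
    have "(\<integral>\<^sup>+t. ennreal (exp (- u * t) * f t) * indicator {0..} t \<partial>lborel)
        = (\<integral>\<^sup>+t. ennreal (exp (- u * t)) * F t * indicator {0..} t \<partial>lborel)"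
      by (intro nn_integral_cong) (auto simp: Ff ennreal_mult' indicator_def)
    then show ?thesis using laplace_moment_inverse_process[OF that, of m] by (simp add: F_def e_def)
  qed
  have gcont: "continuous_on {0..} g"
    unfolding g_def using epos by (intro continuous_intros continuous_on_powr') auto
  have pos: "f t = g t" if "t > 0" for t
  proof (rule laplace_transform_unique_mono[OF _ _ _ _ _ _ that])
    show "mono_on {0..} f" using fmono by (auto simp: mono_on_def)
    show "continuous_on {0..} g" by (rule gcont)
  qed (use lapf lapg cpos in \<open>auto simp: f_def g_def\<close>)
  have "f t = g t"
  proof (cases "t = 0")
    case True
    have "f 0 \<le> 0"
    proof (rule tendsto_le[OF trivial_limit_at_right_real _ tendsto_const])
      have "(g \<longlongrightarrow> g 0) (at 0 within {0..})" using gcont by (simp add: continuous_on_def)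
      then have "(g \<longlongrightarrow> g 0) (at_right 0)" by (rule tendsto_within_subset) auto
      then show "(g \<longlongrightarrow> 0) (at_right 0)" using epos by (simp add: g_def)
      have "f 0 \<le> g s" if "0 < s" for s using fmono[of 0 s] pos[OF that] that by simp
      then show "\<forall>\<^sub>F s in at_right 0. f 0 \<le> g s"
        by (auto simp: eventually_at_filter intro!: always_eventually)
    qed
    moreover have "0 \<le> f 0" by (simp add: f_def)
    ultimately show ?thesis using True epos by (simp add: g_def)
  qed (use t pos in simp)
  moreover have "(t powr \<alpha>) ^ Suc m = t powr e"
    using t by (cases "t = 0") (auto simp: e_def powr_powr powr_realpow[symmetric] mult.commute simp del: power_Suc of_nat_Suc)
  ultimately show ?thesis using Ff[OF t] by (simp only: F_def g_def c_def e_def)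
qed

theorem inverse_process_moment:
  assumes t: "0 \<le> t" and [measurable]: "inverse_process H t \<in> borel_measurable M"
  shows "integrable M (\<lambda>w. inverse_process H t w ^ N)"
    and "expectation (\<lambda>w. inverse_process H t w ^ N) = fact N / Gamma (real N * \<alpha> + 1) * (t powr \<alpha>) ^ N"
proof -
  have "integrable M (\<lambda>w. inverse_process H t w ^ N) \<and>
    expectation (\<lambda>w. inverse_process H t w ^ N) = fact N / Gamma (real N * \<alpha> + 1) * (t powr \<alpha>) ^ N"
  proof (cases N)
    case 0
    then show ?thesis by (simp add: prob_space)
  next
    case (Suc m)
    let ?v = "fact (Suc m) / Gamma (real (Suc m) * \<alpha> + 1) * (t powr \<alpha>) ^ Suc m"
    have G: "Gamma (real (Suc m) * \<alpha> + 1) > 0" using index_pos by (intro Gamma_real_pos) (auto intro: add_pos_pos)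
    have "has_bochner_integral M (\<lambda>w. inverse_process H t w ^ Suc m) ?v"
    proof (rule has_bochner_integral_nn_integral)
      show "AE w in M. 0 \<le> inverse_process H t w ^ Suc m"
        using AE_inverse_process_nonneg[of t] by eventually_elim simp
      show "0 \<le> ?v" using G by (intro mult_nonneg_nonneg divide_nonneg_nonneg) auto
    qed (simp_all only: nn_integral_inverse_process[OF t], measurable)
    then show ?thesis
      unfolding Suc by (simp only: has_bochner_integral_integral_eq integrable.intros)
  qed
  then show "integrable M (\<lambda>w. inverse_process H t w ^ N)"
    "expectation (\<lambda>w. inverse_process H t w ^ N) = fact N / Gamma (real N * \<alpha> + 1) * (t powr \<alpha>) ^ N"
    by auto
qed

end

section \<open>Counts on rectangles\<close>

definition rect :: "real \<Rightarrow> real \<Rightarrow> (real \<times> real) set" where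
  "rect a b = {0..a} \<times> {0..b}"

lemma rect_in_sets: "rect a b \<in> sets (restrict_space borel quadrant)"
proof -
  have "closed quadrant" "closed (rect a b)"
    unfolding quadrant_def rect_def by (auto intro!: closed_Times)
  then have "quadrant \<in> sets borel" "rect a b \<in> sets borel" by auto
  moreover have "rect a b \<subseteq> quadrant" by (auto simp: rect_def quadrant_def)
  ultimately show ?thesis by (simp add: sets_restrict_space_iff)
qed

lemma bounded_rect: "bounded (rect a b)"
  unfolding rect_def by (intro bounded_Times bounded_closed_interval)

lemma measure_lborel_rect:
  assumes "0 \<le> a" "0 \<le> b"
  shows "emeasure lborel (rect a b) = ennreal (a * b)" "measure lborel (rect a b) = a * b"
proof -
  have "emeasure lborel (rect a b) = emeasure (lborel \<Otimes>\<^sub>M lborel) ({0..a} \<times> {0..b})"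
    by (simp add: lborel_prod rect_def)
  also have "\<dots> = ennreal (a * b)"
    using assms by (subst lborel.emeasure_pair_measure_Times) (auto simp: ennreal_mult)
  finally show "emeasure lborel (rect a b) = ennreal (a * b)" .
  then show "measure lborel (rect a b) = a * b" using assms by (simp add: measure_def)
qed

definition rect_count :: "('w \<Rightarrow> (real \<times> real) measure) \<Rightarrow> real \<Rightarrow> real \<Rightarrow> 'w \<Rightarrow> real" where
  "rect_count N a b w = measure (N w) (rect a b)"

text \<open>
  Bounded sets carry finite mass, so nothing is lost by passing from the extended real mass to a
  real number.
\<close>

lemma rect_count_nat:
  assumes "integer_random_measure M N" "w \<in> space M"
  shows "emeasure (N w) (rect a b) < \<infinity>"
    and "\<exists>k::nat. rect_count N a b w = real k"
    and "rect_count N a b w = real j \<longleftrightarrow> emeasure (N w) (rect a b) = of_nat j"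
proof -
  show fin: "emeasure (N w) (rect a b) < \<infinity>"
    using assms rect_in_sets bounded_rect by (auto simp: integer_random_measure_def)
  have "emeasure (N w) (rect a b) \<in> insert \<infinity> (range of_nat)"
    using assms rect_in_sets by (auto simp: integer_random_measure_def)
  then obtain k :: nat where k: "emeasure (N w) (rect a b) = of_nat k" using fin by auto
  then have c: "rect_count N a b w = real k"
    by (simp add: rect_count_def measure_def ennreal_of_nat_eq_real_of_nat)
  then show "\<exists>k::nat. rect_count N a b w = real k" by blast
  show "rect_count N a b w = real j \<longleftrightarrow> emeasure (N w) (rect a b) = of_nat j"
    using c k by (simp add: ennreal_of_nat_eq_real_of_nat)
qed

text \<open>
  Continuity from above of the measure, combined with the fact that a convergent sequence of
  integers is eventually constant.
\<close>

lemma rect_count_dyadic_eventually: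
  assumes N: "integer_random_measure M N" and w: "w \<in> space M" and xy: "0 \<le> x" "0 \<le> y"
  shows "\<forall>\<^sub>F n in sequentially.
    rect_count N (dyadic_above n x) (dyadic_above n y) w = rect_count N x y w"
proof -
  let ?A = "\<lambda>n. rect (dyadic_above n x) (dyadic_above n y)"
  have "decseq ?A"
    using decseqD[OF dyadic_above_decseq[OF xy(1)]] decseqD[OF dyadic_above_decseq[OF xy(2)]]
    by (fastforce simp: decseq_def rect_def intro: order_trans)
  moreover have "range ?A \<subseteq> sets (N w)"
    using N w rect_in_sets by (auto simp: integer_random_measure_def)
  moreover have "emeasure (N w) (?A n) \<noteq> \<infinity>" for n
    using rect_count_nat(1)[OF N w] by (simp add: less_top)
  ultimately have "(\<lambda>n. measure (N w) (?A n)) \<longlonglongrightarrow> measure (N w) (\<Inter>n. ?A n)"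
    by (intro Lim_measure_decseq)
  also have "(\<Inter>n. ?A n) = rect x y"
  proof -
    have "u \<le> z \<longleftrightarrow> (\<forall>n. u \<le> dyadic_above n z)" if "0 \<le> z" for u z
    proof
      show "\<forall>n. u \<le> dyadic_above n z" if "u \<le> z"
        using that dyadic_above_gt[of z] by (meson less_imp_le order_trans)
      show "u \<le> z" if "\<forall>n. u \<le> dyadic_above n z"
        using LIMSEQ_le_const[OF dyadic_above_tendsto[OF \<open>0 \<le> z\<close>], of u] that by blast
    qed
    then show ?thesis using xy by (auto simp: rect_def)
  qed
  finally have "(\<lambda>n. rect_count N (dyadic_above n x) (dyadic_above n y) w) \<longlonglongrightarrow> rect_count N x y w"
    by (simp add: rect_count_def)
  then have "\<forall>\<^sub>F n in sequentially.
      dist (rect_count N (dyadic_above n x) (dyadic_above n y) w) (rect_count N x y w) < 1"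
    by (rule tendstoD) simp
  then show ?thesis
  proof eventually_elim
    case (elim n)
    obtain k l :: nat where "rect_count N (dyadic_above n x) (dyadic_above n y) w = real k"
      "rect_count N x y w = real l"
      using rect_count_nat(2)[OF N w] by metis
    then show ?case using elim by (simp add: dist_real_def)
  qed
qed

lemma rect_count_measurable:
  assumes "integer_random_measure M N"
  shows "rect_count N a b \<in> borel_measurable M"
proof -
  have "(\<lambda>w. emeasure (N w) (rect a b)) \<in> borel_measurable M"
    using assms rect_in_sets by (auto simp: integer_random_measure_def)
  then show ?thesis unfolding rect_count_def[abs_def] measure_def by measurable
qed

lemma dyadic_above_eq: "dyadic_above n x = (\<lambda>k. real (Suc k) / 2 ^ n) (nat \<lfloor>2 ^ n * x\<rfloor>)"
  by (simp add: dyadic_above_def)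

lemma rect_count_dyadic_measurable:
  assumes N: "integer_random_measure M N"
    and [measurable]: "X \<in> borel_measurable M" "Y \<in> borel_measurable M"
  shows "(\<lambda>w. rect_count N (dyadic_above n (X w)) (dyadic_above n (Y w)) w) \<in> borel_measurable M"
proof -
  let ?a = "\<lambda>k. real (Suc k) / 2 ^ n"
  have "(\<lambda>w. rect_count N (?a k) (dyadic_above n (Y w)) w) \<in> borel_measurable M" for k
    unfolding dyadic_above_eq
    by (rule measurable_compose_countable[where f = "\<lambda>l w. rect_count N (?a k) (?a l) w"])
       (auto intro: rect_count_measurable[OF N])
  then show ?thesis
    unfolding dyadic_above_eq[of n "X _"]
    by (rule measurable_compose_countable[where f = "\<lambda>k w. rect_count N (?a k) (dyadic_above n (Y w)) w"]) simp
qed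

text \<open>
  At negative values of \<open>X\<close> or \<open>Y\<close> the rectangle is empty, whereas its dyadic approximations are
  not; hence the approximating variables are set to 0 there.
\<close>

lemma rect_count_random_measurable:
  assumes N: "integer_random_measure M N"
    and [measurable]: "X \<in> borel_measurable M" "Y \<in> borel_measurable M"
  shows "(\<lambda>w. rect_count N (X w) (Y w) w) \<in> borel_measurable M"
proof (rule borel_measurable_LIMSEQ_real)
  let ?Z = "\<lambda>n w. if 0 \<le> X w \<and> 0 \<le> Y w
      then rect_count N (dyadic_above n (X w)) (dyadic_above n (Y w)) w else 0"
  show "?Z n \<in> borel_measurable M" for n
    using rect_count_dyadic_measurable[OF N assms(2,3), of n] by measurable
  show "(\<lambda>n. ?Z n w) \<longlonglongrightarrow> rect_count N (X w) (Y w) w" if w: "w \<in> space M" for w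
  proof (cases "0 \<le> X w \<and> 0 \<le> Y w")
    case True
    then show ?thesis
      using rect_count_dyadic_eventually[OF N w, of "X w" "Y w"] by (auto intro: tendsto_eventually)
  next
    case False
    then have "rect (X w) (Y w) = {}" by (auto simp: rect_def)
    then have "rect_count N (X w) (Y w) w = 0" by (simp add: rect_count_def)
    then show ?thesis using False by (simp only: if_False tendsto_const)
  qed
qed

text \<open>
  Unlike \<open>pmf (poisson_pmf c) k\<close>, this is the right value also for \<open>c = 0\<close>, which occurs for degenerate
  rectangles.
\<close>

definition poisson_weight :: "real \<Rightarrow> nat \<Rightarrow> real" where
  "poisson_weight c k = exp (- c) * c ^ k / fact k"

lemma prob_rect_count:
  assumes N: "poisson_random_field M lam N" and "0 \<le> a" "0 \<le> b"
  shows "measure M {w \<in> space M. rect_count N a b w = real k} = poisson_weight (lam * (a * b)) k"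
proof -
  have "{w \<in> space M. rect_count N a b w = real k} = {w \<in> space M. emeasure (N w) (rect a b) = of_nat k}"
    using N rect_count_nat(3)[of M N] by (auto simp: poisson_random_field_def)
  then show ?thesis
    using assms rect_in_sets[of a b] measure_lborel_rect[of a b]
    by (auto simp: poisson_random_field_def poisson_weight_def)
qed

lemma rect_count_event:
  assumes "integer_random_measure M N"
  shows "{w \<in> space M. rect_count N a b w = real k} \<in> field_events M N"
proof -
  have "{w \<in> space M. rect_count N a b w = real k} =
      (\<lambda>w. emeasure (N w) (rect a b)) -` {of_nat k} \<inter> space M"
    using rect_count_nat(3)[OF assms] by auto
  then show ?thesis
    unfolding field_events_def generated_events_def
    by (auto intro!: sigma_sets.Basic exI[of _ "rect a b"] exI[of _ "{of_nat k}"] rect_in_sets)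
qed

section \<open>Rectangles with a random corner\<close>

text \<open>
  The law of total probability for a countable partition, in the form in which it replaces
  conditioning: \<open>q k\<close> is the conditional probability of \<open>A k\<close> given \<open>K = k\<close>, stated as a product so
  that events \<open>K = k\<close> of probability 0 are included.
\<close>

lemma (in prob_space) prob_countable_mixture:
  fixes K :: "'a \<Rightarrow> 'k::countable"
  assumes [measurable]: "K \<in> measurable M (count_space UNIV)"
    and [measurable]: "\<And>k. A k \<in> events"
    and q: "\<And>k. 0 \<le> q k" "\<And>k. q k \<le> 1"
    and indep: "\<And>k. prob ({w \<in> space M. K w = k} \<inter> A k) = prob {w \<in> space M. K w = k} * q k"
  shows "prob {w \<in> space M. w \<in> A (K w)} = expectation (\<lambda>w. q (K w))"
proof -
  let ?C = "count_space (UNIV :: 'k set)"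
  have pick: "(\<integral>\<^sup>+k. g k * indicator {j} k \<partial>?C) = g j" for g :: "'k \<Rightarrow> ennreal" and j
    by (simp add: nn_integral_indicator_singleton)
  have E: "{w \<in> space M. w \<in> A (K w)} \<in> events"
    by measurable
  have "emeasure M {w \<in> space M. w \<in> A (K w)}
      = (\<integral>\<^sup>+w. indicator {w \<in> space M. w \<in> A (K w)} w \<partial>M)"
    by (rule nn_integral_indicator[OF E, symmetric])
  also have "\<dots> = (\<integral>\<^sup>+w. indicator (A (K w)) w \<partial>M)"
    by (intro nn_integral_cong) (auto simp: indicator_def)
  also have "\<dots> = (\<integral>\<^sup>+w. \<integral>\<^sup>+k. indicator (A k) w * indicator {K w} k \<partial>?C \<partial>M)"
    by (simp only: pick)
  also have "\<dots> = (\<integral>\<^sup>+w. \<integral>\<^sup>+k. indicator ({w \<in> space M. K w = k} \<inter> A k) w \<partial>?C \<partial>M)"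
    by (intro nn_integral_cong) (auto simp: indicator_def)
  also have "\<dots> = (\<integral>\<^sup>+k. \<integral>\<^sup>+w. indicator ({w \<in> space M. K w = k} \<inter> A k) w \<partial>M \<partial>?C)"
    by (rule nn_integral_count_space_nn_integral) auto
  also have "\<dots> = (\<integral>\<^sup>+k. ennreal (q k) * (\<integral>\<^sup>+w. indicator {w \<in> space M. K w = k} w \<partial>M) \<partial>?C)"
    by (intro nn_integral_cong)
       (simp add: emeasure_eq_measure indep ennreal_mult'[symmetric] q mult.commute)
  also have "\<dots> = (\<integral>\<^sup>+k. \<integral>\<^sup>+w. ennreal (q k) * indicator {w \<in> space M. K w = k} w \<partial>M \<partial>?C)"
    by (intro nn_integral_cong nn_integral_cmult[symmetric]) measurable
  also have "\<dots> = (\<integral>\<^sup>+w. \<integral>\<^sup>+k. ennreal (q k) * indicator {w \<in> space M. K w = k} w \<partial>?C \<partial>M)"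
    by (rule nn_integral_count_space_nn_integral[symmetric]) auto
  also have "\<dots> = (\<integral>\<^sup>+w. \<integral>\<^sup>+k. ennreal (q k) * indicator {K w} k \<partial>?C \<partial>M)"
    by (intro nn_integral_cong) (auto simp: indicator_def)
  also have "\<dots> = (\<integral>\<^sup>+w. ennreal (q (K w)) \<partial>M)"
    by (simp only: pick)
  finally have "emeasure M {w \<in> space M. w \<in> A (K w)} = (\<integral>\<^sup>+w. ennreal (q (K w)) \<partial>M)" .
  moreover have "expectation (\<lambda>w. q (K w)) = enn2real (\<integral>\<^sup>+w. ennreal (q (K w)) \<partial>M)"
    by (rule integral_eq_nn_integral) (use q in auto)
  ultimately show ?thesis by (simp add: measure_def)
qed

lemma (in prob_space) indep_sets_four:
  assumes "indep_sets (\<lambda>i. [F0, F1, F2, F3] ! i) {..<4::nat}"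
    and "a \<in> F0" "b \<in> F1" "c \<in> F2" "d \<in> F3"
  shows "prob (c \<inter> d \<inter> (a \<inter> b)) = prob c * prob d * (prob a * prob b)"
    and "prob (c \<inter> d) = prob c * prob d"
proof -
  let ?A = "\<lambda>i. [a, b, c, d] ! i"
  \<comment> \<open>explicit index sets, so that intersections and products unfold\<close>
  have in4: "{..<4::nat} = {0, 1, 2, 3}" by auto
  have mem: "\<forall>j\<in>{0, 1, 2, 3::nat}. ?A j \<in> [F0, F1, F2, F3] ! j"
    using assms by (auto simp: nth_Cons numeral_eq_Suc)
  have "prob (\<Inter>j\<in>{0, 1, 2, 3}. ?A j) = (\<Prod>j\<in>{0, 1, 2, 3}. prob (?A j))"
    using assms(1) mem unfolding in4 by (intro indep_setsD) auto
  moreover have "(\<Inter>j\<in>{0, 1, 2, 3::nat}. ?A j) = c \<inter> d \<inter> (a \<inter> b)"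
    by (auto simp: numeral_eq_Suc)
  ultimately show "prob (c \<inter> d \<inter> (a \<inter> b)) = prob c * prob d * (prob a * prob b)"
    by (simp add: numeral_eq_Suc)
  have "prob (\<Inter>j\<in>{2, 3}. ?A j) = (\<Prod>j\<in>{2, 3}. prob (?A j))"
    using assms(1) mem unfolding in4 by (intro indep_setsD) auto
  then show "prob (c \<inter> d) = prob c * prob d"
    by (simp add: numeral_eq_Suc)
qed

text \<open>
  For the dyadic approximation of the corner this is a countable mixture, with independence of the
  four event classes applied once for each dyadic point. Both sides pass to the limit by
  dominated convergence with the constant bound 1; for the right-hand side the bound holds because
  \<open>q a b\<close> is a product of probabilities.
\<close>

lemma (in prob_space) prob_rect_counts_random_corner:
  assumes N1: "poisson_random_field M lam1 N1" and N2: "poisson_random_field M lam2 N2"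
    and indep: "indep_sets (\<lambda>i. [field_events M N1, field_events M N2, FX, FY] ! i) {..<4::nat}"
    and X: "\<And>A. A \<in> sets borel \<Longrightarrow> X -` A \<inter> space M \<in> FX"
    and Y: "\<And>A. A \<in> sets borel \<Longrightarrow> Y -` A \<inter> space M \<in> FY"
    and meas [measurable]: "X \<in> borel_measurable M" "Y \<in> borel_measurable M"
    and pos: "AE w in M. 0 \<le> X w" "AE w in M. 0 \<le> Y w"
  shows "prob {w \<in> space M. rect_count N1 (X w) (Y w) w = real i \<and> rect_count N2 (X w) (Y w) w = real j}
       = expectation (\<lambda>w. poisson_weight (lam1 * (X w * Y w)) i * poisson_weight (lam2 * (X w * Y w)) j)"
proof -
  have I1: "integer_random_measure M N1" and I2: "integer_random_measure M N2"
    using N1 N2 by (auto simp: poisson_random_field_def)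
  define q where "q a b = poisson_weight (lam1 * (a * b)) i * poisson_weight (lam2 * (a * b)) j" for a b
  have q01: "0 \<le> q a b" "q a b \<le> 1" if "0 \<le> a" "0 \<le> b" for a b
    using that unfolding q_def prob_rect_count[OF N1 that, symmetric] prob_rect_count[OF N2 that, symmetric]
    by (auto intro: mult_le_one)
  have q_cont: "isCont (\<lambda>p. q (fst p) (snd p)) p" for p
    unfolding q_def poisson_weight_def by (intro continuous_intros) auto
  have [measurable]: "(\<lambda>w. q (f w) (g w)) \<in> borel_measurable M"
    if "f \<in> borel_measurable M" "g \<in> borel_measurable M" for f g
    using that unfolding q_def poisson_weight_def by measurable
  have dm [measurable]: "(\<lambda>w. dyadic_above n (f w)) \<in> borel_measurable M"
    if [measurable]: "f \<in> borel_measurable M" for n f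
    unfolding dyadic_above_def by measurable
  let ?X = "\<lambda>n w. dyadic_above n (X w)" and ?Y = "\<lambda>n w. dyadic_above n (Y w)"
  define S where "S n = {w \<in> space M. rect_count N1 (?X n w) (?Y n w) w = real i \<and>
                                      rect_count N2 (?X n w) (?Y n w) w = real j}" for n
  define T where "T = {w \<in> space M. rect_count N1 (X w) (Y w) w = real i \<and>
                                    rect_count N2 (X w) (Y w) w = real j}"
  have [measurable]: "S n \<in> events" for n
    using rect_count_dyadic_measurable[OF I1 meas, of n] rect_count_dyadic_measurable[OF I2 meas, of n]
    unfolding S_def by measurable
  have [measurable]: "T \<in> events"
    using rect_count_random_measurable[OF I1 meas] rect_count_random_measurable[OF I2 meas]
    unfolding T_def by measurable
  have step: "prob (S n) = expectation (\<lambda>w. q (?X n w) (?Y n w))" for n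
  proof -
    let ?a = "\<lambda>k. real (Suc k) / 2 ^ n"
    define K where "K w = (nat \<lfloor>2 ^ n * X w\<rfloor>, nat \<lfloor>2 ^ n * Y w\<rfloor>)" for w
    define A1 where "A1 k = {w \<in> space M. rect_count N1 (?a (fst k)) (?a (snd k)) w = real i}" for k
    define A2 where "A2 k = {w \<in> space M. rect_count N2 (?a (fst k)) (?a (snd k)) w = real j}" for k
    have "prob {w \<in> space M. w \<in> A1 (K w) \<inter> A2 (K w)}
        = expectation (\<lambda>w. (\<lambda>k. q (?a (fst k)) (?a (snd k))) (K w))"
    proof (rule prob_countable_mixture)
      show "K \<in> measurable M (count_space UNIV)"
        unfolding K_def by measurable
      show "A1 k \<inter> A2 k \<in> events" for k
        using rect_count_measurable[OF I1] rect_count_measurable[OF I2]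
        unfolding A1_def A2_def by measurable
      show "0 \<le> q (?a (fst k)) (?a (snd k))" "q (?a (fst k)) (?a (snd k)) \<le> 1" for k
        by (auto intro!: q01)
      fix k :: "nat \<times> nat"
      define C where "C = X -` {x. nat \<lfloor>2 ^ n * x\<rfloor> = fst k} \<inter> space M"
      define D where "D = Y -` {x. nat \<lfloor>2 ^ n * x\<rfloor> = snd k} \<inter> space M"
      have CD: "C \<in> FX" "D \<in> FY"
        unfolding C_def D_def by (intro X Y; measurable)+
      have K: "{w \<in> space M. K w = k} = C \<inter> D"
        by (auto simp: K_def C_def D_def prod_eq_iff)
      have A: "A1 k \<in> field_events M N1" "A2 k \<in> field_events M N2"
        unfolding A1_def A2_def by (intro rect_count_event I1 I2)+
      have "prob (A1 k) * prob (A2 k) = q (?a (fst k)) (?a (snd k))"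
        unfolding A1_def A2_def q_def
        by (subst prob_rect_count[OF N1], simp, simp, subst prob_rect_count[OF N2]) simp_all
      then show "prob ({w \<in> space M. K w = k} \<inter> (A1 k \<inter> A2 k))
          = prob {w \<in> space M. K w = k} * q (?a (fst k)) (?a (snd k))"
        unfolding K using indep_sets_four[OF indep A CD] by simp
    qed
    moreover have "{w \<in> space M. w \<in> A1 (K w) \<inter> A2 (K w)} = S n"
      by (auto simp: S_def A1_def A2_def K_def dyadic_above_def)
    ultimately show ?thesis by (simp add: K_def dyadic_above_def)
  qed
  have "(\<lambda>n. expectation (indicat_real (S n))) \<longlonglongrightarrow> expectation (indicat_real T)"
  proof (rule integral_dominated_convergence[where w = "\<lambda>_. 1"])
    have "AE w in M. w \<in> space M" by simp
    with pos show "AE w in M. (\<lambda>n. indicat_real (S n) w) \<longlonglongrightarrow> indicat_real T w"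
    proof eventually_elim
      case (elim w)
      have "\<forall>\<^sub>F n in sequentially. indicat_real (S n) w = indicat_real T w"
        using rect_count_dyadic_eventually[OF I1 elim(3,1,2)] rect_count_dyadic_eventually[OF I2 elim(3,1,2)]
        by eventually_elim (auto simp: S_def T_def indicator_def)
      then show ?case by (rule tendsto_eventually)
    qed
  qed (auto simp: indicator_def)
  then have "(\<lambda>n. prob (S n)) \<longlonglongrightarrow> prob T" by simp
  moreover have "(\<lambda>n. expectation (\<lambda>w. q (?X n w) (?Y n w))) \<longlonglongrightarrow> expectation (\<lambda>w. q (X w) (Y w))"
  proof (rule integral_dominated_convergence[where w = "\<lambda>_. 1"])
    show "AE w in M. (\<lambda>n. q (?X n w) (?Y n w)) \<longlonglongrightarrow> q (X w) (Y w)"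
      using pos
    proof eventually_elim
      case (elim w)
      show ?case
        using isCont_tendsto_compose[OF q_cont tendsto_Pair[OF dyadic_above_tendsto[OF elim(1)] dyadic_above_tendsto[OF elim(2)]]]
        by simp
    qed
    show "AE w in M. norm (q (?X n w) (?Y n w)) \<le> 1" for n
      using q01[OF less_imp_le[OF dyadic_above_pos] less_imp_le[OF dyadic_above_pos]] by (intro AE_I2) simp
  qed measurable
  ultimately show ?thesis
    unfolding step by (auto simp: T_def q_def intro: LIMSEQ_unique)
qed

section \<open>The distribution of the fractional Skellam field\<close>

text \<open>
  The exponential series is integrated term by term. The absolute values of the terms have
  the expectations \<open>z ^ m * \<mu> (m + r) * (c * z) ^ r / r!\<close>, so the summability hypothesis
  justifies the interchange.
\<close>

lemma (in prob_space) expectation_power_mult_exp: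
  fixes Z :: "'a \<Rightarrow> real"
  assumes [measurable]: "Z \<in> borel_measurable M" and Z0: "AE w in M. 0 \<le> Z w"
    and int: "\<And>N. integrable M (\<lambda>w. Z w ^ N)"
    and moment: "\<And>N. expectation (\<lambda>w. Z w ^ N) = \<mu> N * z ^ N"
    and \<mu>0: "\<And>N. 0 \<le> \<mu> N" and "0 \<le> z" "0 \<le> c"
    and summ: "summable (\<lambda>r. \<mu> (m + r) * (c * z) ^ r / fact r)"
  shows "expectation (\<lambda>w. Z w ^ m * exp (- c * Z w)) = z ^ m * (\<Sum>r. \<mu> (m + r) * (- (c * z)) ^ r / fact r)"
proof -
  define f where "f r w = (- c) ^ r / fact r * Z w ^ (m + r)" for r w
  have fint: "integrable M (f r)" for r
    unfolding f_def using int by simp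
  have norm_f: "norm (f r w) = c ^ r / fact r * \<bar>Z w\<bar> ^ (m + r)" for r w
    using \<open>0 \<le> c\<close> by (simp add: f_def abs_mult power_abs)
  have exp_series: "(\<lambda>r. d ^ r / fact r * y ^ (m + r)) sums (y ^ m * exp (d * y))" for d y :: real
  proof -
    have "(\<lambda>r. y ^ m * (inverse (fact r) * (d * y) ^ r)) sums (y ^ m * exp (d * y))"
      using exp_converges[of "d * y"] by (intro sums_mult) simp
    moreover have "y ^ m * (inverse (fact r) * (d * y) ^ r) = d ^ r / fact r * y ^ (m + r)" for r
      by (simp add: power_add power_mult_distrib divide_inverse)
    ultimately show ?thesis by simp
  qed
  have sumf: "(\<lambda>r. f r w) sums (Z w ^ m * exp (- c * Z w))" for w
    unfolding f_def by (rule exp_series)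
  have Ef: "expectation (\<lambda>w. d ^ r / fact r * Z w ^ (m + r)) = z ^ m * (\<mu> (m + r) * (d * z) ^ r / fact r)" for d r
    unfolding integral_mult_right_zero moment by (simp add: power_add power_mult_distrib)
  have "(\<lambda>r. expectation (f r)) sums expectation (\<lambda>w. \<Sum>r. f r w)"
  proof (rule sums_integral[OF fint])
    show "AE w in M. summable (\<lambda>r. norm (f r w))"
      unfolding norm_f using exp_series[THEN sums_summable] by (intro AE_I2)
    have "expectation (\<lambda>w. norm (f r w)) = expectation (\<lambda>w. c ^ r / fact r * Z w ^ (m + r))" for r
    proof (rule integral_cong_AE)
      show "AE w in M. norm (f r w) = c ^ r / fact r * Z w ^ (m + r)"
        using Z0 by eventually_elim (simp only: norm_f abs_of_nonneg)
      show "(\<lambda>w. norm (f r w)) \<in> borel_measurable M" unfolding f_def by measurable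
    qed measurable
    then show "summable (\<lambda>r. expectation (\<lambda>w. norm (f r w)))"
      using summable_mult[OF summ] by (simp only: Ef)
  qed
  moreover have "expectation (f r) = z ^ m * (\<mu> (m + r) * (- (c * z)) ^ r / fact r)" for r
    using Ef[of "- c" r] by (simp add: f_def[abs_def])
  moreover have "(\<Sum>r. f r w) = Z w ^ m * exp (- c * Z w)" for w
    using sumf by (rule sums_unique[symmetric])
  ultimately have sums: "(\<lambda>r. z ^ m * (\<mu> (m + r) * (- (c * z)) ^ r / fact r)) sums
      expectation (\<lambda>w. Z w ^ m * exp (- c * Z w))"
    by simp
  have "norm (\<mu> (m + r) * (- (c * z)) ^ r / fact r) = \<mu> (m + r) * (c * z) ^ r / fact r" for r
    using \<mu>0 \<open>0 \<le> c\<close> \<open>0 \<le> z\<close> by (simp add: abs_mult power_abs)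
  then have "summable (\<lambda>r. norm (\<mu> (m + r) * (- (c * z)) ^ r / fact r))"
    using summ by (simp only:)
  then have "summable (\<lambda>r. \<mu> (m + r) * (- (c * z)) ^ r / fact r)"
    by (rule summable_norm_cancel)
  then show ?thesis
    using sums_unique2[OF sums sums_mult[OF summable_sums]] by blast
qed

lemma process_event:
  "0 \<le> t \<Longrightarrow> A \<in> sets borel \<Longrightarrow> E t -` A \<inter> space M \<in> process_events M E"
  unfolding process_events_def generated_events_def by (rule sigma_sets.Basic) auto

lemma process_events_marginal:
  assumes "0 \<le> t"
  shows "sigma_sets (space M) {E t -` A \<inter> space M | A. A \<in> sets borel} \<subseteq> process_events M E"
  unfolding process_events_def generated_events_def
  using assms by (intro sigma_sets_mono') auto

text \<open>
  The pairs \<open>(n\<^sup>+ + k, n\<^sup>- + k)\<close> are the pairs of natural numbers with difference \<open>n\<close>. They satisfy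
  \<open>i - j = n\<close> and \<open>i + j = m\<close>, which turns \<open>l1 ^ i * l2 ^ j\<close> into a factor depending on \<open>n\<close> only and
  a symmetric factor; no case distinction on the sign of \<open>n\<close> remains.
\<close>

lemma skellam_weights:
  fixes n :: int and k :: nat and l1 l2 :: real
  assumes "0 < l1" "0 < l2"
  defines "i \<equiv> nat n + k" and "j \<equiv> nat (- n) + k" and "m \<equiv> nat \<bar>n\<bar> + 2 * k"
  shows "i + j = m"
    and "fact i * fact j = (fact (nat \<bar>n\<bar> + k) * fact k :: real)"
    and "l1 ^ i * l2 ^ j = (l1 / l2) powr (of_int n / 2) * sqrt (l1 * l2) ^ m"
proof -
  show "i + j = m" by (simp add: i_def j_def m_def)
  show "fact i * fact j = (fact (nat \<bar>n\<bar> + k) * fact k :: real)"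
    by (cases "0 \<le> n") (simp_all add: i_def j_def)
  have e: "real i = of_int n / 2 + real m / 2" "real j = - (of_int n / 2) + real m / 2"
    by (auto simp: i_def j_def m_def field_simps)
  have "l1 ^ i * l2 ^ j = l1 powr real i * l2 powr real j"
    using assms(1,2) by (simp only: powr_realpow)
  also have "\<dots> = (l1 powr (of_int n / 2) * l2 powr (- (of_int n / 2))) * (l1 powr (real m / 2) * l2 powr (real m / 2))"
    unfolding e powr_add by simp
  also have "l1 powr (of_int n / 2) * l2 powr (- (of_int n / 2)) = (l1 / l2) powr (of_int n / 2)"
    using assms(1,2) powr_divide[of l1 l2 "of_int n / 2"]
    by (simp only: powr_minus divide_inverse[of "_ powr _"] less_imp_le)
  also have "l1 powr (real m / 2) * l2 powr (real m / 2) = sqrt (l1 * l2) ^ m"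
  proof -
    have "sqrt (l1 * l2) ^ m = ((l1 * l2) powr (1 / 2)) powr real m"
      using assms(1,2) by (subst powr_realpow) (auto simp: powr_half_sqrt)
    also have "\<dots> = (l1 * l2) powr (real m / 2)" by (simp add: powr_powr)
    also have "\<dots> = l1 powr (real m / 2) * l2 powr (real m / 2)"
      by (rule powr_mult)
    finally show ?thesis by (rule sym)
  qed
  finally show "l1 ^ i * l2 ^ j = (l1 / l2) powr (of_int n / 2) * sqrt (l1 * l2) ^ m" .
qed

lemma int_split_diff:
  fixes a b :: nat and n :: int
  shows "real a - real b = of_int n \<longleftrightarrow> (\<exists>k. a = nat n + k \<and> b = nat (- n) + k)"
proof -
  have "real a - real b = of_int n \<longleftrightarrow> int a - int b = n"
    by linarith
  also have "\<dots> \<longleftrightarrow> (\<exists>k. a = nat n + k \<and> b = nat (- n) + k)"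
  proof
    assume "int a - int b = n"
    then show "\<exists>k. a = nat n + k \<and> b = nat (- n) + k"
      by (intro exI[of _ "min a b"]) auto
  qed auto
  finally show ?thesis .
qed

theorem theorem5p1:
  fixes M :: "'w measure"
    and N1 N2 :: "'w \<Rightarrow> (real \<times> real) measure"
    and H1 H2 E1 E2 :: "real \<Rightarrow> 'w \<Rightarrow> real"
    and \<alpha> \<beta> lam1 lam2 s t :: real
    and n :: int
  assumes "prob_space M"
    and "0 < \<alpha>" "\<alpha> < 1" "0 < \<beta>" "\<beta> < 1"
    and "0 < lam1" "0 < lam2"
    and "poisson_random_field M lam1 N1" "poisson_random_field M lam2 N2"
    and "stable_subordinator M \<alpha> H1" "stable_subordinator M \<beta> H2"
    and "E1 = inverse_process H1" "E2 = inverse_process H2"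
    and "prob_space.indep_sets M
           (\<lambda>i. [field_events M N1, field_events M N2,
                 process_events M E1, process_events M E2] ! i) {..<4::nat}"
    and "0 \<le> s" "0 \<le> t"
    \<comment> \<open>the Wright functions on the right-hand side have to be defined; for \<open>\<alpha> + \<beta> > 1\<close> this is a
        conclusion, not a hypothesis\<close>
    and "1 < \<alpha> + \<beta> \<or>
         (\<forall>k::nat. wright_converges
            [(real (nat \<bar>n\<bar> + 2 * k + 1), 1), (real (nat \<bar>n\<bar> + 2 * k + 1), 1)]
            [(real (nat \<bar>n\<bar> + 2 * k) * \<alpha> + 1, \<alpha>), (real (nat \<bar>n\<bar> + 2 * k) * \<beta> + 1, \<beta>)]
            (- (lam1 + lam2) * s powr \<alpha> * t powr \<beta>))"
  shows "(\<forall>k::nat. wright_converges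
            [(real (nat \<bar>n\<bar> + 2 * k + 1), 1), (real (nat \<bar>n\<bar> + 2 * k + 1), 1)]
            [(real (nat \<bar>n\<bar> + 2 * k) * \<alpha> + 1, \<alpha>), (real (nat \<bar>n\<bar> + 2 * k) * \<beta> + 1, \<beta>)]
            (- (lam1 + lam2) * s powr \<alpha> * t powr \<beta>)) \<and>
         summable (\<lambda>k::nat.
            (sqrt (lam1 * lam2) * s powr \<alpha> * t powr \<beta>) ^ (nat \<bar>n\<bar> + 2 * k) /
              (fact (nat \<bar>n\<bar> + k) * fact k) *
            wright
              [(real (nat \<bar>n\<bar> + 2 * k + 1), 1), (real (nat \<bar>n\<bar> + 2 * k + 1), 1)]
              [(real (nat \<bar>n\<bar> + 2 * k) * \<alpha> + 1, \<alpha>), (real (nat \<bar>n\<bar> + 2 * k) * \<beta> + 1, \<beta>)]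
              (- (lam1 + lam2) * s powr \<alpha> * t powr \<beta>)) \<and>
         measure M {w \<in> space M. frac_skellam_field N1 N2 E1 E2 s t w = of_int n} =
           (lam1 / lam2) powr (of_int n / 2) *
           (\<Sum>k::nat.
              (sqrt (lam1 * lam2) * s powr \<alpha> * t powr \<beta>) ^ (nat \<bar>n\<bar> + 2 * k) /
                (fact (nat \<bar>n\<bar> + k) * fact k) *
              wright
                [(real (nat \<bar>n\<bar> + 2 * k + 1), 1), (real (nat \<bar>n\<bar> + 2 * k + 1), 1)]
                [(real (nat \<bar>n\<bar> + 2 * k) * \<alpha> + 1, \<alpha>), (real (nat \<bar>n\<bar> + 2 * k) * \<beta> + 1, \<beta>)]
                (- (lam1 + lam2) * s powr \<alpha> * t powr \<beta>))"
proof -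
  interpret prob_space M by fact
  interpret H1: stable_subordinator_space M \<alpha> H1
    using assms by unfold_locales auto
  interpret H2: stable_subordinator_space M \<beta> H2
    using assms by unfold_locales auto
  note N1 = assms(8) and N2 = assms(9) and indep = assms(14)
  define c where "c = lam1 + lam2"
  define z where "z = s powr \<alpha> * t powr \<beta>"
  define x where "x = - (lam1 + lam2) * s powr \<alpha> * t powr \<beta>"
  define m where "m k = nat \<bar>n\<bar> + 2 * k" for k
  define X where "X = E1 s"
  define Y where "Y = E2 t"
  define Z where "Z w = X w * Y w" for w
  let ?\<mu> = "inverse_product_moment \<alpha> \<beta>"
  let ?W = "\<lambda>k. wright
        [(real (m k + 1), 1), (real (m k + 1), 1)]
        [(real (m k) * \<alpha> + 1, \<alpha>), (real (m k) * \<beta> + 1, \<beta>)] x"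
  have c0: "0 \<le> c" and z0: "0 \<le> z" and x_eq: "x = - (c * z)" and absx: "\<bar>x\<bar> = c * z"
  proof -
    show c0: "0 \<le> c" and z0: "0 \<le> z" using assms(6,7) by (auto simp: c_def z_def)
    show x_eq: "x = - (c * z)" by (simp add: x_def c_def z_def algebra_simps)
    show "\<bar>x\<bar> = c * z" using c0 z0 by (simp add: x_eq)
  qed
  have summ: "summable (\<lambda>r. ?\<mu> (m k + r) * \<bar>x\<bar> ^ r / fact r)" for k
    unfolding m_def using assms(2-5) assms(17)[folded x_def] by (rule moment_series_abs_summable)
  have \<mu>0: "0 \<le> ?\<mu> N" for N
    using assms by (intro less_imp_le inverse_product_moment_pos)
  have conv: "wright_converges
        [(real (m k + 1), 1), (real (m k + 1), 1)]
        [(real (m k) * \<alpha> + 1, \<alpha>), (real (m k) * \<beta> + 1, \<beta>)] x" for k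
    unfolding wright_converges_def wright_term_eq[abs_def]
  proof (rule summable_norm_cancel)
    have "norm (?\<mu> (m k + r) * x ^ r / fact r) = ?\<mu> (m k + r) * \<bar>x\<bar> ^ r / fact r" for r
      using \<mu>0 by (simp add: abs_mult power_abs)
    then show "summable (\<lambda>r. norm (?\<mu> (m k + r) * x ^ r / fact r))"
      using summ[of k] by (simp only:)
  qed
  have W_eq: "?W k = (\<Sum>r. ?\<mu> (m k + r) * x ^ r / fact r)" for k
    by (simp only: wright_def wright_term_eq)

  have ev: "process_events M E1 \<subseteq> events" "process_events M E2 \<subseteq> events"
  proof -
    have "[field_events M N1, field_events M N2, process_events M E1, process_events M E2] ! i \<subseteq> events"
      if "i < 4" for i
      using indep that by (auto simp: indep_sets_def)
    from this[of 2] this[of 3] show "process_events M E1 \<subseteq> events" "process_events M E2 \<subseteq> events"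
      by simp_all
  qed
  have X_ev: "X -` A \<inter> space M \<in> process_events M E1" and Y_ev: "Y -` A \<inter> space M \<in> process_events M E2"
    if "A \<in> sets borel" for A
    using that assms(15,16) unfolding X_def Y_def by (auto intro: process_event)
  then have meas: "X \<in> borel_measurable M" "Y \<in> borel_measurable M"
    using ev by (auto simp: measurable_def)
  note [measurable] = meas
  have pos: "AE w in M. 0 \<le> X w" "AE w in M. 0 \<le> Y w"
    using H1.AE_inverse_process_nonneg[of s] H2.AE_inverse_process_nonneg[of t] assms(12,13)
    by (simp_all add: X_def Y_def)

  let ?SX = "sigma_sets (space M) {X -` A \<inter> space M | A. A \<in> sets borel}"
  let ?SY = "sigma_sets (space M) {Y -` A \<inter> space M | A. A \<in> sets borel}"
  have sub: "?SX \<subseteq> process_events M E1" "?SY \<subseteq> process_events M E2"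
    using assms(15,16) unfolding X_def Y_def by (auto dest: process_events_marginal[THEN subsetD])
  have "indep_set ?SX ?SY"
  proof (rule indep_setI)
    show "?SX \<subseteq> events" "?SY \<subseteq> events" using sub ev by auto
    fix a b assume "a \<in> ?SX" "b \<in> ?SY"
    then have "a \<in> process_events M E1" "b \<in> process_events M E2" using sub by auto
    \<comment> \<open>any events of the two fields will do in the four-fold independence\<close>
    moreover have "{} \<in> field_events M N1" "{} \<in> field_events M N2"
      by (simp_all add: field_events_def generated_events_def sigma_sets.Empty)
    ultimately show "prob (a \<inter> b) = prob a * prob b"
      by (intro indep_sets_four(2)[OF indep])
  qed
  then have indepXY: "indep_var borel X borel Y"
    unfolding indep_var_eq using meas by blast

  have Z_moment: "integrable M (\<lambda>w. Z w ^ N)" "expectation (\<lambda>w. Z w ^ N) = ?\<mu> N * z ^ N" for N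
  proof -
    have iN: "indep_var borel (\<lambda>w. X w ^ N) borel (\<lambda>w. Y w ^ N)"
      using indep_var_compose[OF indepXY, of "\<lambda>x. x ^ N" borel "\<lambda>x. x ^ N" borel]
      by (simp add: comp_def)
    have mX: "integrable M (\<lambda>w. X w ^ N)" "expectation (\<lambda>w. X w ^ N)
        = fact N / Gamma (real N * \<alpha> + 1) * (s powr \<alpha>) ^ N"
      using H1.inverse_process_moment[of s N] meas assms(12,15) by (simp_all add: X_def)
    have mY: "integrable M (\<lambda>w. Y w ^ N)" "expectation (\<lambda>w. Y w ^ N)
        = fact N / Gamma (real N * \<beta> + 1) * (t powr \<beta>) ^ N"
      using H2.inverse_process_moment[of t N] meas assms(13,16) by (simp_all add: Y_def)
    show "integrable M (\<lambda>w. Z w ^ N)"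
      using indep_var_integrable[OF iN mX(1) mY(1)] by (simp add: Z_def power_mult_distrib)
    show "expectation (\<lambda>w. Z w ^ N) = ?\<mu> N * z ^ N"
      using indep_var_lebesgue_integral[OF iN mX(1) mY(1)] mX(2) mY(2)
      by (simp add: Z_def power_mult_distrib z_def inverse_product_moment_def power2_eq_square)
  qed
  have Z_exp: "expectation (\<lambda>w. Z w ^ m k * exp (- c * Z w)) = z ^ m k * ?W k" for k
  proof -
    have "expectation (\<lambda>w. Z w ^ m k * exp (- c * Z w))
        = z ^ m k * (\<Sum>r. ?\<mu> (m k + r) * (- (c * z)) ^ r / fact r)"
    proof (rule expectation_power_mult_exp[OF _ _ Z_moment \<mu>0 z0 c0])
      show "Z \<in> borel_measurable M" unfolding Z_def by measurable
      show "AE w in M. 0 \<le> Z w" using pos by eventually_elim (simp add: Z_def)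
      show "summable (\<lambda>r. ?\<mu> (m k + r) * (c * z) ^ r / fact r)"
        using summ[of k] by (simp add: absx)
    qed
    then show ?thesis unfolding W_eq x_eq[symmetric] .
  qed

  define A where "A k = {w \<in> space M. rect_count N1 (X w) (Y w) w = real (nat n + k) \<and>
      rect_count N2 (X w) (Y w) w = real (nat (- n) + k)}" for k
  define S where "S = {w \<in> space M. frac_skellam_field N1 N2 E1 E2 s t w = of_int n}"
  define T where "T k = (sqrt (lam1 * lam2) * s powr \<alpha> * t powr \<beta>) ^ m k /
      (fact (nat \<bar>n\<bar> + k) * fact k) * ?W k" for k
  define R where "R = (lam1 / lam2) powr (of_int n / 2)"
  have R: "R > 0" using assms(6,7) by (simp add: R_def)
  have I: "integer_random_measure M N1" "integer_random_measure M N2"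
    using N1 N2 unfolding poisson_random_field_def by blast+
  have prob_A: "prob (A k) = R * T k" for k
  proof -
    let ?i = "nat n + k" and ?j = "nat (- n) + k"
    note w = skellam_weights[OF assms(6,7), of n k]
    have "prob (A k) = expectation (\<lambda>w. poisson_weight (lam1 * (X w * Y w)) ?i *
        poisson_weight (lam2 * (X w * Y w)) ?j)"
      unfolding A_def by (rule prob_rect_counts_random_corner[OF N1 N2 indep X_ev Y_ev meas pos])
    also have "\<dots> = expectation (\<lambda>w. lam1 ^ ?i * lam2 ^ ?j / (fact ?i * fact ?j) *
        (Z w ^ m k * exp (- c * Z w)))"
    proof (intro Bochner_Integration.integral_cong refl)
      fix w
      have "exp (- c * Z w) = exp (- (lam1 * Z w)) * exp (- (lam2 * Z w))"
        by (simp add: c_def exp_add[symmetric] algebra_simps)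
      moreover have "Z w ^ m k = Z w ^ ?i * Z w ^ ?j"
        using w(1) by (simp only: m_def power_add[symmetric])
      ultimately show "poisson_weight (lam1 * (X w * Y w)) ?i * poisson_weight (lam2 * (X w * Y w)) ?j
          = lam1 ^ ?i * lam2 ^ ?j / (fact ?i * fact ?j) * (Z w ^ m k * exp (- c * Z w))"
        unfolding Z_def[symmetric] by (simp add: poisson_weight_def power_mult_distrib)
    qed
    also have "\<dots> = lam1 ^ ?i * lam2 ^ ?j / (fact ?i * fact ?j) * (z ^ m k * ?W k)"
      unfolding integral_mult_right_zero Z_exp ..
    also have "\<dots> = R * T k"
      unfolding w(2,3) R_def T_def m_def[symmetric] z_def
      by (simp add: power_mult_distrib mult_ac)
    finally show ?thesis .
  qed
  have "(\<lambda>k. prob (A k)) sums prob (\<Union>k. A k)"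
  proof (rule finite_measure_UNION)
    show "range A \<subseteq> events"
      using rect_count_random_measurable[OF I(1) meas] rect_count_random_measurable[OF I(2) meas]
      unfolding A_def by auto
    show "disjoint_family A" by (auto simp: disjoint_family_on_def A_def)
  qed
  moreover have "(\<Union>k. A k) = S"
  proof -
    have "w \<in> S \<longleftrightarrow> (\<exists>k. w \<in> A k)" if w: "w \<in> space M" for w
    proof -
      obtain a b :: nat where ab: "rect_count N1 (X w) (Y w) w = real a" "rect_count N2 (X w) (Y w) w = real b"
        using rect_count_nat(2)[OF I(1) w] rect_count_nat(2)[OF I(2) w] by meson
      have "w \<in> S \<longleftrightarrow> real a - real b = of_int n"
        using w by (simp add: S_def frac_skellam_field_def skellam_field_def ab[symmetric]
            rect_count_def rect_def X_def Y_def)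
      also have "\<dots> \<longleftrightarrow> (\<exists>k. w \<in> A k)"
        unfolding int_split_diff A_def using w by (simp add: ab of_nat_add[symmetric] del: of_nat_add)
      finally show ?thesis .
    qed
    then show ?thesis by (auto simp: S_def A_def)
  qed
  ultimately have "(\<lambda>k. R * T k) sums measure M S" by (simp only: prob_A)
  \<comment> \<open>summability is inherited from the probabilities of the disjoint events \<open>A k\<close>\<close>
  from sums_divide[OF this, of R] have sums_T: "T sums (measure M S / R)"
    using R by simp
  have T_fun: "T = (\<lambda>k. (sqrt (lam1 * lam2) * s powr \<alpha> * t powr \<beta>) ^ m k /
      (fact (nat \<bar>n\<bar> + k) * fact k) * ?W k)"
    by (rule ext) (simp only: T_def)
  have summable_T: "summable T"
    using sums_T by (rule sums_summable)
  have prob_S: "measure M S = R * (\<Sum>k. T k)"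
    unfolding sums_unique[OF sums_T, symmetric] using R by simp
  have 1: "summable (\<lambda>k. (sqrt (lam1 * lam2) * s powr \<alpha> * t powr \<beta>) ^ m k /
      (fact (nat \<bar>n\<bar> + k) * fact k) * ?W k)"
    using summable_T unfolding T_fun .
  have 2: "measure M {w \<in> space M. frac_skellam_field N1 N2 E1 E2 s t w = of_int n} =
      (lam1 / lam2) powr (of_int n / 2) *
      (\<Sum>k. (sqrt (lam1 * lam2) * s powr \<alpha> * t powr \<beta>) ^ m k /
      (fact (nat \<bar>n\<bar> + k) * fact k) * ?W k)"
    using prob_S unfolding S_def R_def T_fun .
  show ?thesis
    unfolding x_def[symmetric] m_def[symmetric]
    by (rule conjI[OF allI[OF conv] conjI[OF 1 2]])
qed

end
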